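(* Consider a MIMO interference channel with partial message sharing (MIMO-IFC-PMS) with radar stations $\mathcal{L}$, base stations $\mathcal{M}$, users $\mathcal{K}=\{1,\dots,K\}$, channel matrices $\tilde{\mathbf H}_{k,l},\tilde{\mathbf H}_{k,m}$, radar projection matrices $\mathbf P_l$, precoders $\mathbf F_{k,l},\mathbf F_{k,m}$ and power budgets $P_l,P_m$, as defined in the context. For each user $k$, list the stations of $\mathcal{M}_k\cup\mathcal{L}_k$ (those informed about user $k$'s message) as $(1)_k,\dots,(M_k+L_k)_k$, where $(1)_k,\dots,(M_k)_k$ are the base stations in $\mathcal{M}_k$ and $(M_k+1)_k,\dots,(M_k+L_k)_k$ are the radar stations in $\mathcal{L}_k$. Then the MIMO-IFC-PMS is a special case of a MIMO interference channel with general constraints (MIMO-IFC-GC, defined in the context), with the following parameters: - $m_{r,k}=n_r$ and $m_{t,k}=M_kn_t+L_kn_{\mathrm{rad}}$; - channel matrices $$\mathbf H_{k,o}=\big[\tilde{\mathbf H}_{k,(1)_o}\ \cdots\ \tilde{\mathbf H}_{k,(M_o)_o}\ \ \tilde{\mathbf H}_{k,(M_o+1)_o}\mathbf P_{(M_o+1)_o}\ \cdots\ \tilde{\mathbf H}_{k,(M_o+L_o)_o}\mathbf P_{(M_o+L_o)_o}\big];$$ - precoding matrices $$\mathbf F_k=\big[\mathbf F_{k,(1)_k}^T\ \cdots\ \mathbf F_{k,(M_k)_k}^T\ \ \mathbf F_{k,(M_k+1)_k}^T\ \cdots\ \mathbf F_{k,(M_k+L_k)_k}^T\big]^T;$$ -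 weight matrices, partitioned into blocks conformally with $\mathbf F_k$ (the $o$-th diagonal block being $n_t\times n_t$ for $o\le M_k$ and $n_{\mathrm{rad}}\times n_{\mathrm{rad}}$ for $o>M_k$): for $l\in\mathcal{L}$, if $l=(o)_k$ then the $o$-th diagonal block of $\mathbf\Phi_{k,l}$ is $\mathbf P_l^H\mathbf P_l$ and all other entries are zero, while $\mathbf\Phi_{k,l}=\mathbf 0$ if $k\notin\mathcal{K}_l$; for $m\in\mathcal{M}$, if $m=(o)_k$ then the $o$-th diagonal block of $\mathbf\Phi_{k,m}$ is $\mathbf I_{n_t}$ and all other entries are zero, while $\mathbf\Phi_{k,m}=\mathbf 0$ if $k\notin\mathcal{K}_m$. That is, these data define a MIMO-IFC-GC, and under this identification the received signals $\mathbf y_k$, $k=1,\dots,K$, and the $L+M$ power constraints of the MIMO-IFC-PMS coincide with the received signals and the $L+M$ generalized linear constraints of the MIMO-IFC-GC.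
   Context: All matrices are complex; $(\cdot)^T$ and $(\cdot)^H$ denote transpose and conjugate transpose. **MIMO-IFC-PMS.** There is a set $\mathcal{L}$ of $L$ radar stations, each with $n_{\mathrm{rad}}$ transmit antennas; a set $\mathcal{M}$ of $M$ base stations, each with $n_t$ transmit antennas; and a set $\mathcal{K}$ of $K$ users, each with $n_r$ receive antennas. Base station $m$ knows the messages of the users in $\mathcal{K}_m\subseteq\mathcal{K}$, and radar $l$ knows the messages of the users in $\mathcal{K}_l\subseteq\mathcal{K}$, with $K_l=|\mathcal{K}_l|$. Put $\mathcal{M}_k=\{m\in\mathcal{M}:k\in\mathcal{K}_m\}$, $M_k=|\mathcal{M}_k|$, $\mathcal{L}_k=\{l\in\mathcal{L}:k\in\mathcal{K}_l\}$, $L_k=|\mathcal{L}_k|$. User $k$ is sent a stream vector $\mathbf u_k\in\mathbb{C}^{d_k}$, $d_k\le\min(L_kn_{\mathrm{rad}}+M_kn_t,\,n_r)$, where $\mathbf u_k\sim\mathcal{CN}(0,\mathbf I)$ and the $\mathbf u_k$ are independent across users. With precoders $\mathbf F_{k,l}\in\mathbb{C}^{n_{\mathrm{rad}}\times d_k}$ and $\mathbf F_{k,m}\in\mathbb{C}^{n_t\times d_k}$, the transmitted signals are $$\tilde{\mathbf x}_l=\mathbf P_l\sum_{k\in\mathcal{K}_l}\mathbf F_{k,l}\mathbf u_k\ (l\in\mathcal{L}),\qquad \tilde{\mathbf x}_m=\sum_{k\in\mathcal{K}_m}\mathbf F_{k,m}\mathbf u_k\ (m\in\mathcal{M}),$$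 subject to the power constraints $$\mathbb{E}\|\tilde{\mathbf x}_l\|^2=\sum_{k\in\mathcal{K}_l}\mathrm{tr}\{\mathbf P_l\mathbf F_{k,l}\mathbf F_{k,l}^H\mathbf P_l^H\}\le P_l,\qquad \mathbb{E}\|\tilde{\mathbf x}_m\|^2=\sum_{k\in\mathcal{K}_m}\mathrm{tr}\{\mathbf F_{k,m}\mathbf F_{k,m}^H\}\le P_m,$$ where the scalars $P_l,P_m$ are given power levels. User $k$ receives $$\mathbf y_k=\sum_{l\in\mathcal{L}}\tilde{\mathbf H}_{k,l}\tilde{\mathbf x}_l+\sum_{m\in\mathcal{M}}\tilde{\mathbf H}_{k,m}\tilde{\mathbf x}_m+\tilde{\mathbf n}_k,$$ with channel matrices $\tilde{\mathbf H}_{k,l}\in\mathbb{C}^{n_r\times n_{\mathrm{rad}}}$, $\tilde{\mathbf H}_{k,m}\in\mathbb{C}^{n_r\times n_t}$ and noise $\tilde{\mathbf n}_k\sim\mathcal{CN}(0,\mathbf I)$. **Projection matrix $\mathbf P_l$ (small singular values space projection).** Let $\tilde{\mathbf H}_l\in\mathbb{C}^{K_ln_r\times n_{\mathrm{rad}}}$ be the vertical stack of the matrices $\tilde{\mathbf H}_{k,l}$, $k\in\mathcal{K}_l$, with singular value decomposition $\tilde{\mathbf H}_l=\mathbf U_l\mathbf\Sigma_l\mathbf V_l^H$, $\mathbf V_l$ an $n_{\mathrm{rad}}\times n_{\mathrm{rad}}$ unitary matrix. Let $\tilde\sigma_{l,1}\ge\tilde\sigma_{l,2}\ge\cdots\ge\tilde\sigma_{l,p}\ge0$,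 $p=\min(K_ln_r,n_{\mathrm{rad}})$, be the singular values of $\tilde{\mathbf H}_l$, and set $\tilde\sigma_{l,u}=0$ for $p<u\le n_{\mathrm{rad}}$. For a given singular value threshold $\sigma_{\mathrm{th}}\ge 0$, let $\tilde\sigma'_{l,u}=0$ if $\tilde\sigma_{l,u}>\sigma_{\mathrm{th}}$ and $\tilde\sigma'_{l,u}=1$ if $\tilde\sigma_{l,u}\le\sigma_{\mathrm{th}}$. Then $\mathbf P_l=\mathbf V_l\,\mathrm{diag}(\tilde\sigma'_{l,1},\dots,\tilde\sigma'_{l,n_{\mathrm{rad}}})\,\mathbf V_l^H\in\mathbb{C}^{n_{\mathrm{rad}}\times n_{\mathrm{rad}}}$. **MIMO-IFC-GC.** There are $K$ transmitters, the $k$-th with $m_{t,k}$ antennas, and $K$ receivers, the $k$-th with $m_{r,k}$ antennas. Receiver $k$ receives $$\mathbf y_k=\mathbf H_{k,k}\mathbf x_k+\sum_{o\ne k}\mathbf H_{k,o}\mathbf x_o+\mathbf n_k,$$ where $\mathbf n_k\sim\mathcal{CN}(0,\mathbf I)$, $\mathbf H_{k,o}\in\mathbb{C}^{m_{r,k}\times m_{t,o}}$, and $\mathbf x_k=\mathbf F_k\mathbf u_k\in\mathbb{C}^{m_{t,k}}$ with $\mathbf F_k\in\mathbb{C}^{m_{t,k}\times d_k}$, $\mathbf u_k\in\mathbb{C}^{d_k}$, $\mathbf u_k\sim\mathcal{CN}(0,\mathbf I)$, $d_k\le\min(m_{t,k},m_{r,k})$. The inputs must satisfy the generalized linear constraints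 $$\sum_{k=1}^K\mathrm{tr}\{\mathbf\Phi_{k,l}\mathbf F_k\mathbf F_k^H\}\le P_l\ (l=1,\dots,L),\qquad \sum_{k=1}^K\mathrm{tr}\{\mathbf\Phi_{k,m}\mathbf F_k\mathbf F_k^H\}\le P_m\ (m=1,\dots,M),$$ for weight matrices $\mathbf\Phi_{k,l},\mathbf\Phi_{k,m}\in\mathbb{C}^{m_{t,k}\times m_{t,k}}$ such that $\sum_{l=1}^L\mathbf\Phi_{k,l}+\sum_{m=1}^M\mathbf\Phi_{k,m}$ is positive definite for all $k=1,\dots,K$.
   Formalization: Positive definiteness of the weight sums fails when a radar singular value exceeds the threshold (e.g. H=1, σ_th=0 gives P_l=0). Proved instead: the sums are always positive semidefinite, and the data form a MIMO-IFC-GC exactly when no singular value exceeds σ_th; all else is unconditional. *)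

theory Defs
  imports
    "HOL-Probability.Probability"
    "Jordan_Normal_Form.Schur_Decomposition"
begin

unbundle no vec_syntax

section \<open>Matrices and vectors\<close>

definition mtrace :: "complex mat \<Rightarrow> complex" where
  "mtrace A = (\<Sum>i<dim_row A. A $$ (i, i))"

definition norm_sq :: "complex vec \<Rightarrow> real" where
  "norm_sq x = (\<Sum>i<dim_vec x. (cmod (x $ i))\<^sup>2)"

definition mat_sum :: "nat \<Rightarrow> ('a \<Rightarrow> complex mat) \<Rightarrow> 'a set \<Rightarrow> complex mat" where
  "mat_sum n f I = mat n n (\<lambda>ij. \<Sum>a\<in>I. f a $$ ij)"

definition hermitian :: "nat \<Rightarrow> complex mat \<Rightarrow> bool" where
  "hermitian n A \<longleftrightarrow> A \<in> carrier_mat n n \<and> mat_adjoint A = A"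

text \<open>Here \<open>(A *\<^sub>v x) \<bullet>c x\<close> is \<open>x\<^sup>H A x\<close>.\<close>

definition positive_definite :: "nat \<Rightarrow> complex mat \<Rightarrow> bool" where
  "positive_definite n A \<longleftrightarrow> hermitian n A \<and>
     (\<forall>x\<in>carrier_vec n. x \<noteq> 0\<^sub>v n \<longrightarrow> 0 < Re ((A *\<^sub>v x) \<bullet>c x))"

definition positive_semidefinite :: "nat \<Rightarrow> complex mat \<Rightarrow> bool" where
  "positive_semidefinite n A \<longleftrightarrow> hermitian n A \<and>
     (\<forall>x\<in>carrier_vec n. 0 \<le> Re ((A *\<^sub>v x) \<bullet>c x))"

definition unitary_mat :: "nat \<Rightarrow> complex mat \<Rightarrow> bool" where
  "unitary_mat n U \<longleftrightarrow> U \<in> carrier_mat n n \<and>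
     mat_adjoint U * U = 1\<^sub>m n \<and> U * mat_adjoint U = 1\<^sub>m n"

definition is_svd :: "nat \<Rightarrow> nat \<Rightarrow> complex mat \<Rightarrow> complex mat \<Rightarrow> complex mat \<Rightarrow> complex mat \<Rightarrow> bool" where
  "is_svd m n A U D V \<longleftrightarrow>
     A \<in> carrier_mat m n \<and> unitary_mat m U \<and> D \<in> carrier_mat m n \<and> unitary_mat n V \<and>
     (\<forall>i<m. \<forall>j<n. i \<noteq> j \<longrightarrow> D $$ (i, j) = 0) \<and>
     (\<forall>i<min m n. D $$ (i, i) \<in> \<real> \<and> 0 \<le> Re (D $$ (i, i))) \<and>
     (\<forall>i j. i \<le> j \<and> j < min m n \<longrightarrow> Re (D $$ (j, j)) \<le> Re (D $$ (i, i))) \<and>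
     A = U * D * mat_adjoint V"

text \<open>Block row \<open>[A\<^sub>1 \<dots> A\<^sub>s]\<close> of matrices with \<open>nr\<close> rows, and block column of matrices
  with \<open>nc\<close> columns.\<close>

fun hcat :: "nat \<Rightarrow> complex mat list \<Rightarrow> complex mat" where
  "hcat nr [] = 0\<^sub>m nr 0"
| "hcat nr (A # As) = (let B = hcat nr As in
     four_block_mat A B (0\<^sub>m 0 (dim_col A)) (0\<^sub>m 0 (dim_col B)))"

definition vcat :: "nat \<Rightarrow> complex mat list \<Rightarrow> complex mat" where
  "vcat nc As = transpose_mat (hcat nc (map transpose_mat As))"

section \<open>Complex Gaussian random vectors\<close>

text \<open>\<open>CN(0,1)\<close>: real and imaginary parts independent and distributed as \<open>N(0,1/2)\<close>.\<close>

definition std_complex_normal :: "complex measure" where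
  "std_complex_normal =
     (let N = density lborel (\<lambda>x. ennreal (normal_density 0 (sqrt (1/2)) x))
      in distr (N \<Otimes>\<^sub>M N) borel (\<lambda>(x, y). Complex x y))"

text \<open>The type \<open>complex vec\<close> carries no \<open>\<sigma>\<close>-algebra, so a random vector with values in
  \<open>carrier_vec d\<close> is regarded as a random element of the product space over the index set
  \<open>{..<d}\<close>.\<close>

abbreviation cspace :: "nat \<Rightarrow> (nat \<Rightarrow> complex) measure" where
  "cspace d \<equiv> (\<Pi>\<^sub>M i\<in>{..<d}. borel)"

definition vec_fun :: "nat \<Rightarrow> complex vec \<Rightarrow> nat \<Rightarrow> complex" where
  "vec_fun d v = (\<lambda>i\<in>{..<d}. v $ i)"

text \<open>\<open>X \<sim> CN(0, I\<^sub>d)\<close>.\<close>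

definition std_complex_normal_vec :: "'w measure \<Rightarrow> nat \<Rightarrow> ('w \<Rightarrow> complex vec) \<Rightarrow> bool" where
  "std_complex_normal_vec W d X \<longleftrightarrow>
     (\<forall>\<omega>\<in>space W. X \<omega> \<in> carrier_vec d) \<and>
     (\<lambda>\<omega>. vec_fun d (X \<omega>)) \<in> measurable W (cspace d) \<and>
     distr W (cspace d) (\<lambda>\<omega>. vec_fun d (X \<omega>)) = (\<Pi>\<^sub>M i\<in>{..<d}. std_complex_normal)"

section \<open>Interference channel with partial message sharing\<close>

text \<open>Users are \<open>1, \<dots>, num_users\<close>. The radar precoders \<open>Fr k l\<close> and base station precoders
  \<open>Fb k m\<close> are the design variables and hence not part of the record. \<open>svd_U l\<close>, \<open>svd_D l\<close>,
  \<open>svd_V l\<close> is the chosen singular value decomposition of the stacked channel of radar \<open>l\<close>.\<close>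

record ('l, 'm, 'w) pms =
  radars :: "'l set"
  base_stations :: "'m set"
  num_users :: nat
  n_rad :: nat
  n_t :: nat
  n_r :: nat
  radar_msgs :: "'l \<Rightarrow> nat set"
  bs_msgs :: "'m \<Rightarrow> nat set"
  streams :: "nat \<Rightarrow> nat"
  radar_chan :: "nat \<Rightarrow> 'l \<Rightarrow> complex mat"
  bs_chan :: "nat \<Rightarrow> 'm \<Rightarrow> complex mat"
  radar_power :: "'l \<Rightarrow> real"
  bs_power :: "'m \<Rightarrow> real"
  sv_threshold :: real
  svd_U :: "'l \<Rightarrow> complex mat"
  svd_D :: "'l \<Rightarrow> complex mat"
  svd_V :: "'l \<Rightarrow> complex mat"
  prob_sp :: "'w measure"
  symbols :: "nat \<Rightarrow> 'w \<Rightarrow> complex vec"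
  noise :: "nat \<Rightarrow> 'w \<Rightarrow> complex vec"

definition users :: "('l, 'm, 'w) pms \<Rightarrow> nat set" where
  "users S = {1..num_users S}"

definition bs_of :: "('l, 'm, 'w) pms \<Rightarrow> nat \<Rightarrow> 'm set" where
  "bs_of S k = {m \<in> base_stations S. k \<in> bs_msgs S m}"

definition radars_of :: "('l, 'm, 'w) pms \<Rightarrow> nat \<Rightarrow> 'l set" where
  "radars_of S k = {l \<in> radars S. k \<in> radar_msgs S l}"

definition radar_stack :: "('l, 'm, 'w) pms \<Rightarrow> 'l \<Rightarrow> complex mat" where
  "radar_stack S l =
     vcat (n_rad S) (map (\<lambda>k. radar_chan S k l) (sorted_list_of_set (radar_msgs S l)))"

text \<open>The index \<open>u\<close> of singular values runs over \<open>{..<n_rad S}\<close>.\<close>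

definition sing_val :: "('l, 'm, 'w) pms \<Rightarrow> 'l \<Rightarrow> nat \<Rightarrow> real" where
  "sing_val S l u =
     (if u < min (card (radar_msgs S l) * n_r S) (n_rad S) then Re (svd_D S l $$ (u, u)) else 0)"

definition radar_proj :: "('l, 'm, 'w) pms \<Rightarrow> 'l \<Rightarrow> complex mat" where
  "radar_proj S l =
     svd_V S l * mat_diag (n_rad S) (\<lambda>u. if sing_val S l u > sv_threshold S then 0 else 1)
       * mat_adjoint (svd_V S l)"

definition mimo_ifc_pms :: "('l, 'm, 'w) pms \<Rightarrow> bool" where
  "mimo_ifc_pms S \<longleftrightarrow>
     finite (radars S) \<and> finite (base_stations S) \<and>
     (\<forall>l\<in>radars S. radar_msgs S l \<subseteq> users S) \<and>
     (\<forall>m\<in>base_stations S. bs_msgs S m \<subseteq> users S) \<and>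
     (\<forall>k\<in>users S. \<forall>l\<in>radars S. radar_chan S k l \<in> carrier_mat (n_r S) (n_rad S)) \<and>
     (\<forall>k\<in>users S. \<forall>m\<in>base_stations S. bs_chan S k m \<in> carrier_mat (n_r S) (n_t S)) \<and>
     (\<forall>k\<in>users S. streams S k \<le>
        min (card (radars_of S k) * n_rad S + card (bs_of S k) * n_t S) (n_r S)) \<and>
     0 \<le> sv_threshold S \<and>
     (\<forall>l\<in>radars S. is_svd (card (radar_msgs S l) * n_r S) (n_rad S) (radar_stack S l)
        (svd_U S l) (svd_D S l) (svd_V S l)) \<and>
     prob_space (prob_sp S) \<and>
     (\<forall>k\<in>users S. std_complex_normal_vec (prob_sp S) (streams S k) (symbols S k)) \<and>
     prob_space.indep_vars (prob_sp S) (\<lambda>k. cspace (streams S k))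
        (\<lambda>k \<omega>. vec_fun (streams S k) (symbols S k \<omega>)) (users S) \<and>
     (\<forall>k\<in>users S. std_complex_normal_vec (prob_sp S) (n_r S) (noise S k))"

definition pms_precoders ::
  "('l, 'm, 'w) pms \<Rightarrow> (nat \<Rightarrow> 'l \<Rightarrow> complex mat) \<Rightarrow> (nat \<Rightarrow> 'm \<Rightarrow> complex mat) \<Rightarrow> bool" where
  "pms_precoders S Fr Fb \<longleftrightarrow>
     (\<forall>k\<in>users S. \<forall>l\<in>radars_of S k. Fr k l \<in> carrier_mat (n_rad S) (streams S k)) \<and>
     (\<forall>k\<in>users S. \<forall>m\<in>bs_of S k. Fb k m \<in> carrier_mat (n_t S) (streams S k))"

definition radar_signal ::
  "('l, 'm, 'w) pms \<Rightarrow> (nat \<Rightarrow> 'l \<Rightarrow> complex mat) \<Rightarrow> 'l \<Rightarrow> 'w \<Rightarrow> complex vec" where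
  "radar_signal S Fr l \<omega> = radar_proj S l *\<^sub>v
     finsum_vec TYPE(complex) (n_rad S) (\<lambda>k. Fr k l *\<^sub>v symbols S k \<omega>) (radar_msgs S l)"

definition bs_signal ::
  "('l, 'm, 'w) pms \<Rightarrow> (nat \<Rightarrow> 'm \<Rightarrow> complex mat) \<Rightarrow> 'm \<Rightarrow> 'w \<Rightarrow> complex vec" where
  "bs_signal S Fb m \<omega> =
     finsum_vec TYPE(complex) (n_t S) (\<lambda>k. Fb k m *\<^sub>v symbols S k \<omega>) (bs_msgs S m)"

definition pms_received ::
  "('l, 'm, 'w) pms \<Rightarrow> (nat \<Rightarrow> 'l \<Rightarrow> complex mat) \<Rightarrow> (nat \<Rightarrow> 'm \<Rightarrow> complex mat)
     \<Rightarrow> nat \<Rightarrow> 'w \<Rightarrow> complex vec" where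
  "pms_received S Fr Fb k \<omega> =
     finsum_vec TYPE(complex) (n_r S) (\<lambda>l. radar_chan S k l *\<^sub>v radar_signal S Fr l \<omega>) (radars S)
     + finsum_vec TYPE(complex) (n_r S) (\<lambda>m. bs_chan S k m *\<^sub>v bs_signal S Fb m \<omega>) (base_stations S)
     + noise S k \<omega>"

definition radar_tx_power ::
  "('l, 'm, 'w) pms \<Rightarrow> (nat \<Rightarrow> 'l \<Rightarrow> complex mat) \<Rightarrow> 'l \<Rightarrow> real" where
  "radar_tx_power S Fr l = (LINT \<omega>|prob_sp S. norm_sq (radar_signal S Fr l \<omega>))"

definition bs_tx_power ::
  "('l, 'm, 'w) pms \<Rightarrow> (nat \<Rightarrow> 'm \<Rightarrow> complex mat) \<Rightarrow> 'm \<Rightarrow> real" where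
  "bs_tx_power S Fb m = (LINT \<omega>|prob_sp S. norm_sq (bs_signal S Fb m \<omega>))"

definition radar_tx_trace ::
  "('l, 'm, 'w) pms \<Rightarrow> (nat \<Rightarrow> 'l \<Rightarrow> complex mat) \<Rightarrow> 'l \<Rightarrow> complex" where
  "radar_tx_trace S Fr l = (\<Sum>k\<in>radar_msgs S l.
     mtrace (radar_proj S l * Fr k l * mat_adjoint (Fr k l) * mat_adjoint (radar_proj S l)))"

definition bs_tx_trace ::
  "('l, 'm, 'w) pms \<Rightarrow> (nat \<Rightarrow> 'm \<Rightarrow> complex mat) \<Rightarrow> 'm \<Rightarrow> complex" where
  "bs_tx_trace S Fb m = (\<Sum>k\<in>bs_msgs S m. mtrace (Fb k m * mat_adjoint (Fb k m)))"

definition pms_radar_constraint ::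
  "('l, 'm, 'w) pms \<Rightarrow> (nat \<Rightarrow> 'l \<Rightarrow> complex mat) \<Rightarrow> 'l \<Rightarrow> bool" where
  "pms_radar_constraint S Fr l \<longleftrightarrow> radar_tx_power S Fr l \<le> radar_power S l"

definition pms_bs_constraint ::
  "('l, 'm, 'w) pms \<Rightarrow> (nat \<Rightarrow> 'm \<Rightarrow> complex mat) \<Rightarrow> 'm \<Rightarrow> bool" where
  "pms_bs_constraint S Fb m \<longleftrightarrow> bs_tx_power S Fb m \<le> bs_power S m"

section \<open>Interference channel with general constraints\<close>

text \<open>The two families of generalized linear constraints are indexed by finite sets
  \<open>gc_L\<close> and \<open>gc_M\<close>. \<open>gc_chan k o\<close> is the channel from transmitter \<open>o\<close> to receiver \<open>k\<close>.\<close>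

record ('l, 'm, 'w) gc =
  gc_L :: "'l set"
  gc_M :: "'m set"
  gc_num :: nat
  gc_tx :: "nat \<Rightarrow> nat"
  gc_rx :: "nat \<Rightarrow> nat"
  gc_streams :: "nat \<Rightarrow> nat"
  gc_chan :: "nat \<Rightarrow> nat \<Rightarrow> complex mat"
  gc_weight_L :: "nat \<Rightarrow> 'l \<Rightarrow> complex mat"
  gc_weight_M :: "nat \<Rightarrow> 'm \<Rightarrow> complex mat"
  gc_bound_L :: "'l \<Rightarrow> real"
  gc_bound_M :: "'m \<Rightarrow> real"
  gc_prob :: "'w measure"
  gc_symbols :: "nat \<Rightarrow> 'w \<Rightarrow> complex vec"
  gc_noise :: "nat \<Rightarrow> 'w \<Rightarrow> complex vec"

definition gc_users :: "('l, 'm, 'w) gc \<Rightarrow> nat set" where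
  "gc_users G = {1..gc_num G}"

definition gc_weight_sum :: "('l, 'm, 'w) gc \<Rightarrow> nat \<Rightarrow> complex mat" where
  "gc_weight_sum G k =
     mat_sum (gc_tx G k) (gc_weight_L G k) (gc_L G) + mat_sum (gc_tx G k) (gc_weight_M G k) (gc_M G)"

text \<open>All requirements on the channel except definiteness of the weight sums, which is added
  in \<open>mimo_ifc_gc\<close>. It is kept apart because \<open>P\<^sub>l\<^sup>H P\<^sub>l\<close> is singular for a radar with a
  singular value above the threshold, and then the weight sums of the channel built from message
  sharing are only semidefinite.\<close>

definition gc_model :: "('l, 'm, 'w) gc \<Rightarrow> bool" where
  "gc_model G \<longleftrightarrow>
     finite (gc_L G) \<and> finite (gc_M G) \<and>
     (\<forall>k\<in>gc_users G. \<forall>j\<in>gc_users G. gc_chan G k j \<in> carrier_mat (gc_rx G k) (gc_tx G j)) \<and>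
     (\<forall>k\<in>gc_users G. gc_streams G k \<le> min (gc_tx G k) (gc_rx G k)) \<and>
     (\<forall>k\<in>gc_users G. \<forall>l\<in>gc_L G. gc_weight_L G k l \<in> carrier_mat (gc_tx G k) (gc_tx G k)) \<and>
     (\<forall>k\<in>gc_users G. \<forall>m\<in>gc_M G. gc_weight_M G k m \<in> carrier_mat (gc_tx G k) (gc_tx G k)) \<and>
     prob_space (gc_prob G) \<and>
     (\<forall>k\<in>gc_users G. std_complex_normal_vec (gc_prob G) (gc_streams G k) (gc_symbols G k)) \<and>
     (\<forall>k\<in>gc_users G. std_complex_normal_vec (gc_prob G) (gc_rx G k) (gc_noise G k))"

definition mimo_ifc_gc :: "('l, 'm, 'w) gc \<Rightarrow> bool" where
  "mimo_ifc_gc G \<longleftrightarrow>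
     gc_model G \<and> (\<forall>k\<in>gc_users G. positive_definite (gc_tx G k) (gc_weight_sum G k))"

definition gc_precoders :: "('l, 'm, 'w) gc \<Rightarrow> (nat \<Rightarrow> complex mat) \<Rightarrow> bool" where
  "gc_precoders G F \<longleftrightarrow> (\<forall>k\<in>gc_users G. F k \<in> carrier_mat (gc_tx G k) (gc_streams G k))"

definition gc_signal ::
  "('l, 'm, 'w) gc \<Rightarrow> (nat \<Rightarrow> complex mat) \<Rightarrow> nat \<Rightarrow> 'w \<Rightarrow> complex vec" where
  "gc_signal G F k \<omega> = F k *\<^sub>v gc_symbols G k \<omega>"

definition gc_received ::
  "('l, 'm, 'w) gc \<Rightarrow> (nat \<Rightarrow> complex mat) \<Rightarrow> nat \<Rightarrow> 'w \<Rightarrow> complex vec" where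
  "gc_received G F k \<omega> =
     gc_chan G k k *\<^sub>v gc_signal G F k \<omega>
     + finsum_vec TYPE(complex) (gc_rx G k) (\<lambda>j. gc_chan G k j *\<^sub>v gc_signal G F j \<omega>)
         (gc_users G - {k})
     + gc_noise G k \<omega>"

definition gc_lhs_L :: "('l, 'm, 'w) gc \<Rightarrow> (nat \<Rightarrow> complex mat) \<Rightarrow> 'l \<Rightarrow> complex" where
  "gc_lhs_L G F l = (\<Sum>k\<in>gc_users G. mtrace (gc_weight_L G k l * F k * mat_adjoint (F k)))"

definition gc_lhs_M :: "('l, 'm, 'w) gc \<Rightarrow> (nat \<Rightarrow> complex mat) \<Rightarrow> 'm \<Rightarrow> complex" where
  "gc_lhs_M G F m = (\<Sum>k\<in>gc_users G. mtrace (gc_weight_M G k m * F k * mat_adjoint (F k)))"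

text \<open>The order on complex numbers is the one of \<open>HOL-Library.Complex_Order\<close>: these inequalities
  say that the left-hand side is real and bounded by the right-hand side.\<close>

definition gc_constraint_L :: "('l, 'm, 'w) gc \<Rightarrow> (nat \<Rightarrow> complex mat) \<Rightarrow> 'l \<Rightarrow> bool" where
  "gc_constraint_L G F l \<longleftrightarrow> gc_lhs_L G F l \<le> complex_of_real (gc_bound_L G l)"

definition gc_constraint_M :: "('l, 'm, 'w) gc \<Rightarrow> (nat \<Rightarrow> complex mat) \<Rightarrow> 'm \<Rightarrow> bool" where
  "gc_constraint_M G F m \<longleftrightarrow> gc_lhs_M G F m \<le> complex_of_real (gc_bound_M G m)"

section \<open>The identification\<close>

text \<open>\<open>bl k\<close> and \<open>rl k\<close> list, in an arbitrary order, the base stations and the radars informed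
  about the message of user \<open>k\<close>; the station \<open>(o)\<^sub>k\<close> is entry \<open>o\<close> of \<open>bl k @ rl k\<close>.\<close>

definition station_listing ::
  "('l, 'm, 'w) pms \<Rightarrow> (nat \<Rightarrow> 'm list) \<Rightarrow> (nat \<Rightarrow> 'l list) \<Rightarrow> bool" where
  "station_listing S bl rl \<longleftrightarrow> (\<forall>k\<in>users S.
     distinct (bl k) \<and> set (bl k) = bs_of S k \<and> distinct (rl k) \<and> set (rl k) = radars_of S k)"

definition stacked_tx :: "('l, 'm, 'w) pms \<Rightarrow> nat \<Rightarrow> nat" where
  "stacked_tx S k = card (bs_of S k) * n_t S + card (radars_of S k) * n_rad S"

definition stacked_chan ::
  "('l, 'm, 'w) pms \<Rightarrow> (nat \<Rightarrow> 'm list) \<Rightarrow> (nat \<Rightarrow> 'l list) \<Rightarrow> nat \<Rightarrow> nat \<Rightarrow> complex mat" where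
  "stacked_chan S bl rl k j =
     hcat (n_r S) (map (bs_chan S k) (bl j) @ map (\<lambda>l. radar_chan S k l * radar_proj S l) (rl j))"

definition stacked_precoder ::
  "('l, 'm, 'w) pms \<Rightarrow> (nat \<Rightarrow> 'm list) \<Rightarrow> (nat \<Rightarrow> 'l list) \<Rightarrow>
     (nat \<Rightarrow> 'l \<Rightarrow> complex mat) \<Rightarrow> (nat \<Rightarrow> 'm \<Rightarrow> complex mat) \<Rightarrow> nat \<Rightarrow> complex mat" where
  "stacked_precoder S bl rl Fr Fb k =
     vcat (streams S k) (map (Fb k) (bl k) @ map (Fr k) (rl k))"

definition stacked_weight_radar ::
  "('l, 'm, 'w) pms \<Rightarrow> (nat \<Rightarrow> 'm list) \<Rightarrow> (nat \<Rightarrow> 'l list) \<Rightarrow> nat \<Rightarrow> 'l \<Rightarrow> complex mat" where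
  "stacked_weight_radar S bl rl k l =
     (if k \<in> radar_msgs S l then
        diag_block_mat (map (\<lambda>m. 0\<^sub>m (n_t S) (n_t S)) (bl k) @
          map (\<lambda>l'. if l' = l then mat_adjoint (radar_proj S l) * radar_proj S l
                    else 0\<^sub>m (n_rad S) (n_rad S)) (rl k))
      else 0\<^sub>m (stacked_tx S k) (stacked_tx S k))"

definition stacked_weight_bs ::
  "('l, 'm, 'w) pms \<Rightarrow> (nat \<Rightarrow> 'm list) \<Rightarrow> (nat \<Rightarrow> 'l list) \<Rightarrow> nat \<Rightarrow> 'm \<Rightarrow> complex mat" where
  "stacked_weight_bs S bl rl k m =
     (if k \<in> bs_msgs S m then
        diag_block_mat (map (\<lambda>m'. if m' = m then 1\<^sub>m (n_t S) else 0\<^sub>m (n_t S) (n_t S)) (bl k) @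
          map (\<lambda>l. 0\<^sub>m (n_rad S) (n_rad S)) (rl k))
      else 0\<^sub>m (stacked_tx S k) (stacked_tx S k))"

definition gc_of_pms ::
  "('l, 'm, 'w) pms \<Rightarrow> (nat \<Rightarrow> 'm list) \<Rightarrow> (nat \<Rightarrow> 'l list) \<Rightarrow> ('l, 'm, 'w) gc" where
  "gc_of_pms S bl rl =
     \<lparr> gc_L = radars S, gc_M = base_stations S, gc_num = num_users S,
       gc_tx = stacked_tx S, gc_rx = (\<lambda>k. n_r S), gc_streams = streams S,
       gc_chan = stacked_chan S bl rl,
       gc_weight_L = stacked_weight_radar S bl rl, gc_weight_M = stacked_weight_bs S bl rl,
       gc_bound_L = radar_power S, gc_bound_M = bs_power S,
       gc_prob = prob_sp S, gc_symbols = symbols S, gc_noise = noise S \<rparr>"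

end

theory Submission
  imports Defs
begin

text \<open>Both channels are compared block by block, the blocks being indexed by the stations informed
  about a user. Multiplying the block row of channels by the block column of precoders and
  exchanging the sums over stations and over users gives the received signals. The coordinates of all
  symbol vectors form an orthonormal family in \<open>L\<^sup>2\<close>, so the expected power of a linear
  combination \<open>\<Sum>\<^sub>k G\<^sub>k u\<^sub>k\<close> is \<open>\<Sum>\<^sub>k tr (G\<^sub>k G\<^sub>k\<^sup>H)\<close>; cyclicity of the trace turns
  this into the generalized constraint. The sum of the weight matrices of a user is block diagonal
  with blocks \<open>I\<close> and \<open>P\<^sub>l\<^sup>H P\<^sub>l\<close>, and \<open>P\<^sub>l\<close> is injective exactly when no singular value
  exceeds the threshold.\<close>

section \<open>Second moments of complex Gaussian vectors\<close>

text \<open>The stations of a user come as two lists over different types, with blocks of different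
  sizes. They are merged into one list over the sum type, and the block size becomes a function of
  the station. Each block identity is then one induction over an index list, and blocks fit together
  because both factors refer to the same size function. Power is an expectation and so real by type,
  whereas the generalized constraints bound a complex trace in the complex order; equating the trace
  with \<open>complex_of_real\<close> of the power supplies realness and bound at once. Definiteness
  of the weight sums is the one requirement that can fail: suppressing a strong direction of a radar
  channel is what creates a null vector of \<open>P_l^H P_l\<close>. Hence the result combines
  unconditional model properties and semidefiniteness with an equivalence that says when
  definiteness holds.\<close>

lemma borel_measurable_cnj [measurable]: "cnj \<in> borel_measurable borel"
  by (intro borel_measurable_continuous_onI continuous_intros)

text \<open>Each real component has variance 1/2, so the two second moments add up to 1. Every
  integrand needed here is a sum of functions of a single component, which reduces the claims to
  moments of a real normal variable.\<close>

lemma std_complex_normal_moments: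
  shows prob_space_std_complex_normal: "prob_space std_complex_normal"
    and sets_std_complex_normal: "sets std_complex_normal = sets borel"
    and integrable_std_complex_normal: "integrable std_complex_normal (\<lambda>z. z)"
    and integral_std_complex_normal: "(\<integral>z. z \<partial>std_complex_normal) = 0"
    and integrable_std_complex_normal_sq: "integrable std_complex_normal (\<lambda>z. z * cnj z)"
    and integral_std_complex_normal_sq: "(\<integral>z. z * cnj z \<partial>std_complex_normal) = 1"
proof -
  define N where "N = density lborel (\<lambda>x. ennreal (normal_density 0 (sqrt (1/2)) x))"
  have s: "0 < sqrt (1/2 :: real)" by simp
  interpret N: prob_space N unfolding N_def by (rule prob_space_normal_density[OF s])
  interpret NN: pair_prob_space N N ..
  have setsN [measurable_cong]: "sets N = sets borel" by (simp add: N_def)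
  have i1: "integrable N (\<lambda>x. x)" and e1: "(\<integral>x. x \<partial>N) = 0"
    using integrable_normal_moment_nz_1[OF s, of 0] integral_normal_moment_nz_1[OF s, of 0]
    by (auto simp: N_def integrable_density integral_density normal_density_nonneg)
  have i2: "integrable N (\<lambda>x. x\<^sup>2)" and e2: "(\<integral>x. x\<^sup>2 \<partial>N) = 1/2"
    using integrable_normal_moment[OF s, of 0 2] integral_normal_moment_even[OF s, of 0 1]
    by (auto simp: N_def integrable_density integral_density normal_density_nonneg fact_2 power2_eq_square)
  have D: "std_complex_normal = distr (N \<Otimes>\<^sub>M N) borel (\<lambda>(x, y). Complex x y)"
    by (simp add: std_complex_normal_def N_def Let_def)
  have C: "(\<lambda>(x, y). Complex x y) = (\<lambda>p. complex_of_real (fst p) + \<i> * complex_of_real (snd p))"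
    by (auto simp: fun_eq_iff complex_eq_iff)
  have M [measurable]: "(\<lambda>(x, y). Complex x y) \<in> measurable (N \<Otimes>\<^sub>M N) borel"
    unfolding C by measurable
  show "prob_space std_complex_normal" unfolding D by (rule NN.prob_space_distr) simp
  show "sets std_complex_normal = sets borel" by (simp add: D)
  \<comment> \<open>A function of one component can be integrated against the corresponding
    marginal, and both marginals of the product are \<open>N\<close>.\<close>
  have fst': "integrable (N \<Otimes>\<^sub>M N) (\<lambda>p. f (fst p))" "(\<integral>p. f (fst p) \<partial>(N \<Otimes>\<^sub>M N)) = (\<integral>x. f x \<partial>N)"
    and snd': "integrable (N \<Otimes>\<^sub>M N) (\<lambda>p. f (snd p))" "(\<integral>p. f (snd p) \<partial>(N \<Otimes>\<^sub>M N)) = (\<integral>x. f x \<partial>N)"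
    if "integrable N f" for f :: "real \<Rightarrow> real"
  proof -
    have m [measurable]: "f \<in> borel_measurable N" using that by simp
    have d1: "distr (N \<Otimes>\<^sub>M N) N fst = N" by (rule N.distr_pair_fst)
    \<comment> \<open>The second marginal is obtained from the first because the product measure is
      invariant under swapping components.\<close>
    have "distr (N \<Otimes>\<^sub>M N) N snd = distr (distr (N \<Otimes>\<^sub>M N) (N \<Otimes>\<^sub>M N) (\<lambda>(x, y). (y, x))) N snd"
      using NN.distr_pair_swap by simp
    also have "\<dots> = distr (N \<Otimes>\<^sub>M N) N (snd \<circ> (\<lambda>(x, y). (y, x)))" by (rule distr_distr) auto
    also have "snd \<circ> (\<lambda>(x, y). (y, x)) = (fst :: real \<times> real \<Rightarrow> real)" by auto
    finally have d2: "distr (N \<Otimes>\<^sub>M N) N snd = N" using d1 by simp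
    show "integrable (N \<Otimes>\<^sub>M N) (\<lambda>p. f (fst p))"
      using integrable_distr[of fst "N \<Otimes>\<^sub>M N" N f] d1 that by simp
    show "integrable (N \<Otimes>\<^sub>M N) (\<lambda>p. f (snd p))"
      using integrable_distr[of snd "N \<Otimes>\<^sub>M N" N f] d2 that by simp
    show "(\<integral>p. f (fst p) \<partial>(N \<Otimes>\<^sub>M N)) = (\<integral>x. f x \<partial>N)"
      using integral_distr[of fst "N \<Otimes>\<^sub>M N" N f] d1 by simp
    show "(\<integral>p. f (snd p) \<partial>(N \<Otimes>\<^sub>M N)) = (\<integral>x. f x \<partial>N)"
      using integral_distr[of snd "N \<Otimes>\<^sub>M N" N f] d2 by simp
  qed
  note [simp] = fst'[OF i1] fst'[OF i2] snd'[OF i1] snd'[OF i2] e1 e2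
  show "integrable std_complex_normal (\<lambda>z. z)"
    unfolding D by (subst integrable_distr_eq[OF M]) (auto simp: C)
  show "(\<integral>z. z \<partial>std_complex_normal) = 0"
    unfolding D by (subst integral_distr[OF M]) (auto simp: C)
  have sq: "(\<lambda>p. (case p of (x, y) \<Rightarrow> Complex x y) * cnj (case p of (x, y) \<Rightarrow> Complex x y))
     = (\<lambda>p. complex_of_real ((fst p)\<^sup>2 + (snd p)\<^sup>2))"
    by (auto simp: fun_eq_iff complex_eq_iff power2_eq_square)
  show "integrable std_complex_normal (\<lambda>z. z * cnj z)"
    unfolding D by (subst integrable_distr_eq[OF M]) (auto simp: sq simp del: of_real_add of_real_power)
  show "(\<integral>z. z * cnj z \<partial>std_complex_normal) = 1"
    unfolding D by (subst integral_distr[OF M]) (auto simp: sq simp del: of_real_add of_real_power)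
qed

text \<open>The law of the coordinate function is a product measure, so integrals of products of
  one-variable functions factor. One- and two-coordinate moments are the cases in which all
  remaining factors are the constant 1.\<close>

lemma std_complex_normal_vec_moments:
  assumes W: "prob_space W" and X: "std_complex_normal_vec W d X"
  shows std_complex_normal_vec_integrable: "i < d \<Longrightarrow> integrable W (\<lambda>\<omega>. X \<omega> $ i)"
    and std_complex_normal_vec_mean: "i < d \<Longrightarrow> (\<integral>\<omega>. X \<omega> $ i \<partial>W) = 0"
    and std_complex_normal_vec_integrable_prod: "i < d \<Longrightarrow> j < d \<Longrightarrow>
      integrable W (\<lambda>\<omega>. X \<omega> $ i * cnj (X \<omega> $ j))"
    and std_complex_normal_vec_covariance: "i < d \<Longrightarrow> j < d \<Longrightarrow>
      (\<integral>\<omega>. X \<omega> $ i * cnj (X \<omega> $ j) \<partial>W) = (if i = j then 1 else 0)"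
proof -
  define V where "V = (\<lambda>\<omega>. vec_fun d (X \<omega>))"
  have mV: "V \<in> measurable W (cspace d)"
    and dV: "distr W (cspace d) V = (\<Pi>\<^sub>M i\<in>{..<d}. std_complex_normal)"
    using X by (auto simp: std_complex_normal_vec_def V_def)
  interpret Z: prob_space std_complex_normal by (rule prob_space_std_complex_normal)
  interpret PZ: product_prob_space "\<lambda>_. std_complex_normal" "{..<d}" ..
  have c: "V \<omega> i = X \<omega> $ i" if "i < d" for i \<omega> using that by (simp add: V_def vec_fun_def)
  have cnj_int: "integrable std_complex_normal cnj" "(\<integral>z. cnj z \<partial>std_complex_normal) = 0"
    using integrable_cnj[OF integrable_std_complex_normal]
      Bochner_Integration.integral_cnj[where M = std_complex_normal and f = "\<lambda>z. z"] integral_std_complex_normal by auto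
  \<comment> \<open>Factorization over the product measure, pulled back to the sample space along
    \<open>dV\<close>.\<close>
  have *: "integrable W (\<lambda>\<omega>. \<Prod>i<d. f i (V \<omega> i)) \<and>
      (\<integral>\<omega>. (\<Prod>i<d. f i (V \<omega> i)) \<partial>W) = (\<Prod>i<d. \<integral>z. f i z \<partial>std_complex_normal)"
    if f: "\<And>i. i < d \<Longrightarrow> integrable std_complex_normal (f i)" for f :: "nat \<Rightarrow> complex \<Rightarrow> complex"
  proof -
    have i1: "integrable (\<Pi>\<^sub>M i\<in>{..<d}. std_complex_normal) (\<lambda>x. \<Prod>i<d. f i (x i))"
      by (rule PZ.product_integrable_prod) (auto simp: f)
    have i2: "(\<integral>x. (\<Prod>i<d. f i (x i)) \<partial>(\<Pi>\<^sub>M i\<in>{..<d}. std_complex_normal)) = (\<Prod>i<d. \<integral>z. f i z \<partial>std_complex_normal)"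
      by (rule PZ.product_integral_prod) (auto simp: f)
    have "f i \<in> borel_measurable borel" if "i < d" for i
      using borel_measurable_integrable[OF f[OF that]]
      by (simp add: measurable_cong_sets[OF sets_std_complex_normal refl])
    then have fm: "(\<lambda>x. \<Prod>i<d. f i (x i)) \<in> borel_measurable (cspace d)"
      by (intro borel_measurable_prod) (auto intro!: measurable_compose[OF measurable_component_singleton])
    show ?thesis
      using i1 i2 unfolding dV[symmetric]
      by (simp add: integrable_distr_eq[OF mV fm] integral_distr[OF mV fm])
  qed
  have si: "integrable W (\<lambda>\<omega>. g (V \<omega> i)) \<and> (\<integral>\<omega>. g (V \<omega> i) \<partial>W) = (\<integral>z. g z \<partial>std_complex_normal)"
    if "i < d" "integrable std_complex_normal g" for i and g :: "complex \<Rightarrow> complex"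
  proof -
    have "(\<Prod>l<d. (if l = i then g else (\<lambda>_. 1)) (V \<omega> l)) = g (V \<omega> i)" for \<omega>
      using that(1) by (subst prod.cong[OF refl, where h = "\<lambda>l. if l = i then g (V \<omega> i) else 1"]) auto
    moreover have "(\<Prod>l<d. \<integral>z. (if l = i then g else (\<lambda>_. 1)) z \<partial>std_complex_normal) = (\<integral>z. g z \<partial>std_complex_normal)"
      using that(1) by (subst prod.cong[OF refl, where h = "\<lambda>l. if l = i then (\<integral>z. g z \<partial>std_complex_normal) else 1"]) (auto simp: Z.prob_space)
    ultimately show ?thesis using *[of "\<lambda>l. if l = i then g else (\<lambda>_. 1)"] that(2) by simp
  qed
  show "integrable W (\<lambda>\<omega>. X \<omega> $ i)" "(\<integral>\<omega>. X \<omega> $ i \<partial>W) = 0" if "i < d"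
    using si[OF that integrable_std_complex_normal] integral_std_complex_normal c[OF that] by auto
  have two: "integrable W (\<lambda>\<omega>. X \<omega> $ i * cnj (X \<omega> $ j)) \<and>
      (\<integral>\<omega>. X \<omega> $ i * cnj (X \<omega> $ j) \<partial>W) = (if i = j then 1 else 0)" if ij: "i < d" "j < d" for i j
  proof (cases "i = j")
    case True
    then show ?thesis
      using si[OF ij(1) integrable_std_complex_normal_sq] integral_std_complex_normal_sq c[OF ij(1)] by auto
  next
    case False
    \<comment> \<open>For distinct coordinates the factor at \<open>i\<close> is the identity, whose
      integral is 0; this annihilates the whole product.\<close>
    let ?f = "\<lambda>l. if l = i then (\<lambda>z. z) else if l = j then cnj else (\<lambda>_. 1)"
    have split: "prod h {..<d} = h i * (h j * prod h ({..<d} - {i} - {j}))" for h :: "nat \<Rightarrow> complex"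
      using False ij by (simp add: prod.remove[where x = i] prod.remove[where x = j])
    have "(\<Prod>l<d. ?f l (V \<omega> l)) = X \<omega> $ i * cnj (X \<omega> $ j)" for \<omega>
      unfolding split using False by (simp add: c ij)
    moreover have "(\<Prod>l<d. \<integral>z. ?f l z \<partial>std_complex_normal) = 0"
      unfolding split using integral_std_complex_normal by simp
    moreover have "integrable std_complex_normal (?f l)" for l
      using integrable_std_complex_normal cnj_int by simp
    ultimately show ?thesis using *[of ?f] False by simp
  qed
  show "integrable W (\<lambda>\<omega>. X \<omega> $ i * cnj (X \<omega> $ j))"
    "(\<integral>\<omega>. X \<omega> $ i * cnj (X \<omega> $ j) \<partial>W) = (if i = j then 1 else 0)" if "i < d" "j < d"
    using two[OF that] by auto
qed

text \<open>Independence across users turns the expectation of the product into a product of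
  expectations, and the coordinates have mean 0.\<close>

lemma indep_std_complex_normal_vec_covariance:
  assumes W: "prob_space W" and I: "k \<in> I" "k' \<in> I" "k \<noteq> k'"
    and X: "\<And>k. k \<in> I \<Longrightarrow> std_complex_normal_vec W (d k) (X k)"
    and ind: "prob_space.indep_vars W (\<lambda>k. cspace (d k)) (\<lambda>k \<omega>. vec_fun (d k) (X k \<omega>)) I"
    and ij: "i < d k" "j < d k'"
  shows "integrable W (\<lambda>\<omega>. X k \<omega> $ i * cnj (X k' \<omega> $ j))"
    and "(\<integral>\<omega>. X k \<omega> $ i * cnj (X k' \<omega> $ j) \<partial>W) = 0"
proof -
  interpret prob_space W by fact
  \<comment> \<open>The conjugation is placed into the function applied to user \<open>k'\<close>,
    so that the product over the two-element family is exactly the wanted integrand.\<close>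
  define Y where "Y = (\<lambda>l (v :: nat \<Rightarrow> complex). if l = k then v i else cnj (v j))"
  have ind2: "indep_vars (\<lambda>k. cspace (d k)) (\<lambda>k \<omega>. vec_fun (d k) (X k \<omega>)) {k, k'}"
    by (rule indep_vars_subset[OF ind]) (use I in auto)
  have iY: "indep_vars (\<lambda>_. borel) (\<lambda>l \<omega>. Y l (vec_fun (d l) (X l \<omega>))) {k, k'}"
    by (rule indep_vars_compose2[OF ind2]) (use ij I(3) in \<open>auto simp: Y_def intro: measurable_compose[OF _ borel_measurable_cnj]\<close>)
  have Yk: "Y k (vec_fun (d k) (X k \<omega>)) = X k \<omega> $ i" for \<omega>
    using ij by (simp add: Y_def vec_fun_def)
  have Yk': "Y k' (vec_fun (d k') (X k' \<omega>)) = cnj (X k' \<omega> $ j)" for \<omega>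
    using ij I(3) by (simp add: Y_def vec_fun_def)
  note int1 = std_complex_normal_vec_integrable[OF W X[OF I(1)] ij(1)]
  note int2 = std_complex_normal_vec_integrable[OF W X[OF I(2)] ij(2)]
  have int: "integrable W (\<lambda>\<omega>. Y l (vec_fun (d l) (X l \<omega>)))" if "l \<in> {k, k'}" for l
    using that int1 int2 by (auto simp: Yk Yk')
  have "(\<lambda>\<omega>. \<Prod>l\<in>{k, k'}. Y l (vec_fun (d l) (X l \<omega>))) = (\<lambda>\<omega>. X k \<omega> $ i * cnj (X k' \<omega> $ j))"
    using I(3) by (simp add: Yk Yk')
  with indep_vars_integrable[OF _ iY int] indep_vars_lebesgue_integral[OF _ iY int]
    std_complex_normal_vec_mean[OF W X[OF I(1)] ij(1)] I(3)
  show "integrable W (\<lambda>\<omega>. X k \<omega> $ i * cnj (X k' \<omega> $ j))"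
    and "(\<integral>\<omega>. X k \<omega> $ i * cnj (X k' \<omega> $ j) \<partial>W) = 0"
    by (simp_all add: Yk)
qed

text \<open>Parseval's identity for a finite orthonormal family in the Hilbert space of
  square-integrable functions. The squared modulus is expanded in the complex numbers, where the
  off-diagonal terms live, and realness is recovered at the end by injectivity of
  \<open>complex_of_real\<close>.\<close>

lemma integral_norm_sq_orthonormal:
  fixes c :: "'a \<Rightarrow> complex" and z :: "'a \<Rightarrow> 'w \<Rightarrow> complex"
  assumes "finite J"
    and int: "\<And>a b. a \<in> J \<Longrightarrow> b \<in> J \<Longrightarrow> integrable W (\<lambda>\<omega>. z a \<omega> * cnj (z b \<omega>))"
    and orth: "\<And>a b. a \<in> J \<Longrightarrow> b \<in> J \<Longrightarrow> (\<integral>\<omega>. z a \<omega> * cnj (z b \<omega>) \<partial>W) = (if a = b then 1 else 0)"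
  shows "integrable W (\<lambda>\<omega>. (cmod (\<Sum>a\<in>J. c a * z a \<omega>))\<^sup>2)"
    and "(\<integral>\<omega>. (cmod (\<Sum>a\<in>J. c a * z a \<omega>))\<^sup>2 \<partial>W) = (\<Sum>a\<in>J. (cmod (c a))\<^sup>2)"
proof -
  have eq: "complex_of_real ((cmod (\<Sum>a\<in>J. c a * z a \<omega>))\<^sup>2)
      = (\<Sum>a\<in>J. \<Sum>b\<in>J. (c a * cnj (c b)) * (z a \<omega> * cnj (z b \<omega>)))" for \<omega>
    unfolding complex_norm_square cnj_sum sum_product by (intro sum.cong refl) simp
  have i: "integrable W (\<lambda>\<omega>. complex_of_real ((cmod (\<Sum>a\<in>J. c a * z a \<omega>))\<^sup>2))"
    unfolding eq by (intro Bochner_Integration.integrable_sum integrable_mult_right int)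
  then show "integrable W (\<lambda>\<omega>. (cmod (\<Sum>a\<in>J. c a * z a \<omega>))\<^sup>2)"
    unfolding complex_of_real_integrable_eq .
  have "complex_of_real (\<integral>\<omega>. (cmod (\<Sum>a\<in>J. c a * z a \<omega>))\<^sup>2 \<partial>W)
      = (\<integral>\<omega>. (\<Sum>a\<in>J. \<Sum>b\<in>J. (c a * cnj (c b)) * (z a \<omega> * cnj (z b \<omega>))) \<partial>W)"
    unfolding eq[symmetric] by (rule integral_complex_of_real[symmetric])
  also have "\<dots> = (\<Sum>a\<in>J. \<Sum>b\<in>J. (c a * cnj (c b)) * (if a = b then 1 else 0))"
    by (simp add: Bochner_Integration.integral_sum int orth cong: sum.cong)
  also have "\<dots> = (\<Sum>a\<in>J. c a * cnj (c a))"
    using \<open>finite J\<close> by (simp add: if_distrib cong: if_cong)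
  also have "\<dots> = complex_of_real (\<Sum>a\<in>J. (cmod (c a))\<^sup>2)"
    by (simp only: of_real_sum complex_norm_square)
  finally show "(\<integral>\<omega>. (cmod (\<Sum>a\<in>J. c a * z a \<omega>))\<^sup>2 \<partial>W) = (\<Sum>a\<in>J. (cmod (c a))\<^sup>2)"
    unfolding of_real_eq_iff .
qed

section \<open>Adjoints, block matrices and definiteness\<close>

lemma mat_adjoint_index:
  assumes "i < dim_col A" "j < dim_row A"
  shows "mat_adjoint A $$ (i, j) = cnj (A $$ (j, i))"
  using assms by (simp add: mat_adjoint_def mat_of_rows_def)

lemma mat_adjoint_dim [simp]:
  "dim_row (mat_adjoint A) = dim_col A" "dim_col (mat_adjoint A) = dim_row A"
  by (simp_all add: mat_adjoint_def)

lemma mat_adjoint_carrier [simp]: "A \<in> carrier_mat n m \<Longrightarrow> mat_adjoint A \<in> carrier_mat m n"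
  by (rule carrier_matI) auto

lemma mat_adjoint_mat_adjoint [simp]: "mat_adjoint (mat_adjoint A) = (A :: complex mat)"
  by (rule eq_matI) (simp_all add: mat_adjoint_index)

lemma mat_adjoint_mult:
  assumes "A \<in> carrier_mat n m" "B \<in> carrier_mat m r"
  shows "mat_adjoint (A * B) = mat_adjoint B * mat_adjoint (A :: complex mat)"
proof (rule eq_matI)
  show "mat_adjoint (A * B) $$ (i, j) = (mat_adjoint B * mat_adjoint A) $$ (i, j)"
    if "i < dim_row (mat_adjoint B * mat_adjoint A)" "j < dim_col (mat_adjoint B * mat_adjoint A)" for i j
  proof -
    have ij: "i < r" "j < n" using that assms by auto
    then have "mat_adjoint (A * B) $$ (i, j) = (\<Sum>k<m. cnj (A $$ (j, k)) * cnj (B $$ (k, i)))"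
      using assms by (simp add: mat_adjoint_index scalar_prod_def lessThan_atLeast0)
    also have "\<dots> = (mat_adjoint B * mat_adjoint A) $$ (i, j)"
      using assms ij by (simp add: mat_adjoint_index scalar_prod_def lessThan_atLeast0 mult.commute)
    finally show ?thesis .
  qed
qed (use assms in auto)

lemma inner_mat_adjoint:
  fixes A :: "complex mat"
  assumes A: "A \<in> carrier_mat n m" and x: "x \<in> carrier_vec m" and y: "y \<in> carrier_vec n"
  shows "(A *\<^sub>v x) \<bullet>c y = x \<bullet>c (mat_adjoint A *\<^sub>v y)"
proof -
  have "(A *\<^sub>v x) \<bullet>c y = (\<Sum>i<n. \<Sum>j<m. A $$ (i, j) * x $ j * cnj (y $ i))"
    using assms by (simp add: scalar_prod_def lessThan_atLeast0 sum_distrib_right)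
  also have "\<dots> = (\<Sum>j<m. \<Sum>i<n. A $$ (i, j) * x $ j * cnj (y $ i))"
    by (rule sum.swap)
  also have "\<dots> = x \<bullet>c (mat_adjoint A *\<^sub>v y)"
    using assms by (simp add: scalar_prod_def lessThan_atLeast0 sum_distrib_left mat_adjoint_index mult_ac)
  finally show ?thesis .
qed

lemma inner_self_Re: "Re (x \<bullet>c x) = norm_sq x" "Im (x \<bullet>c x) = 0"
  by (simp_all add: scalar_prod_def norm_sq_def lessThan_atLeast0 cmod_def power2_eq_square)

lemma norm_sq_nonneg: "0 \<le> norm_sq x"
  by (simp add: norm_sq_def sum_nonneg)

lemma norm_sq_pos_iff: "x \<in> carrier_vec n \<Longrightarrow> 0 < norm_sq x \<longleftrightarrow> x \<noteq> 0\<^sub>v n"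
proof -
  assume x: "x \<in> carrier_vec n"
  have "norm_sq x = 0 \<longleftrightarrow> (\<forall>i<n. x $ i = 0)"
    using x by (auto simp: norm_sq_def sum_nonneg_eq_0_iff)
  also have "\<dots> \<longleftrightarrow> x = 0\<^sub>v n" using x by (auto intro!: eq_vecI)
  finally show ?thesis using norm_sq_nonneg[of x] by linarith
qed

text \<open>This is the Frobenius inner product. Its entrywise form splits along row blocks and
  matches the sums of squared moduli arising from expected powers.\<close>

lemma mtrace_mult_adjoint:
  assumes "A \<in> carrier_mat n m" "B \<in> carrier_mat n m"
  shows "mtrace (A * mat_adjoint B) = (\<Sum>i<n. \<Sum>j<m. A $$ (i, j) * cnj (B $$ (i, j)))"
  using assms by (simp add: mtrace_def scalar_prod_def lessThan_atLeast0 mat_adjoint_index)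

section \<open>Block rows and block columns\<close>

lemma hcat_carrier:
  "(\<And>A. A \<in> set As \<Longrightarrow> dim_row A = nr) \<Longrightarrow> hcat nr As \<in> carrier_mat nr (sum_list (map dim_col As))"
proof (induction As)
  case (Cons A As)
  have "dim_row A = nr" using Cons.prems by simp
  moreover have H: "hcat nr As \<in> carrier_mat nr (sum_list (map dim_col As))"
    by (rule Cons.IH) (use Cons.prems in simp)
  ultimately have "hcat nr (A # As) \<in> carrier_mat (nr + 0) (dim_col A + sum_list (map dim_col As))"
    unfolding hcat.simps Let_def carrier_matD[OF H]
    by (intro four_block_carrier_mat) auto
  then show ?case by simp
qed simp

text \<open>Sizes are given by a function \<open>d\<close> of the index instead of being read off
  the blocks, so that the columns of a block row and the rows of a block column are counted by the
  same term.\<close>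

lemma hcat_map_carrier:
  assumes "\<And>x. x \<in> set xs \<Longrightarrow> f x \<in> carrier_mat nr (d x)"
  shows "hcat nr (map f xs) \<in> carrier_mat nr (\<Sum>x\<leftarrow>xs. d x)"
proof -
  have "(\<Sum>x\<leftarrow>xs. dim_col (f x)) = (\<Sum>x\<leftarrow>xs. d x)"
    using assms by (intro arg_cong[where f = sum_list]) auto
  moreover have "dim_row A = nr" if "A \<in> set (map f xs)" for A using assms that by auto
  ultimately show ?thesis using hcat_carrier[of "map f xs" nr] by (simp add: comp_def)
qed

lemma vcat_map_carrier:
  assumes "\<And>x. x \<in> set xs \<Longrightarrow> g x \<in> carrier_mat (d x) nc"
  shows "vcat nc (map g xs) \<in> carrier_mat (\<Sum>x\<leftarrow>xs. d x) nc"
  using hcat_map_carrier[of xs "transpose_mat \<circ> g" nc d] assms by (simp add: vcat_def comp_def)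

lemma vcat_Cons:
  assumes B: "B \<in> carrier_mat r nc" and Bs: "vcat nc Bs \<in> carrier_mat s nc"
  shows "vcat nc (B # Bs) = B @\<^sub>r vcat nc Bs"
proof -
  have H: "hcat nc (map transpose_mat Bs) \<in> carrier_mat nc s"
    using Bs by (auto simp: vcat_def)
  show ?thesis
    using B H unfolding vcat_def append_rows_def
    by (simp add: Let_def transpose_four_block_mat[of _ nc r _ s _ 0])
qed

lemma hcat_Cons_mult_append:
  assumes A: "A \<in> carrier_mat nr r" and As: "hcat nr As \<in> carrier_mat nr s"
    and a: "a \<in> carrier_vec r" and b: "b \<in> carrier_vec s"
  shows "hcat nr (A # As) *\<^sub>v (a @\<^sub>v b) = A *\<^sub>v a + hcat nr As *\<^sub>v b"
proof -
  \<comment> \<open>The empty lower blocks in the definition of \<open>hcat\<close> contribute a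
    vector of dimension 0.\<close>
  have "hcat nr (A # As) *\<^sub>v (a @\<^sub>v b)
      = (A *\<^sub>v a + hcat nr As *\<^sub>v b) @\<^sub>v (0\<^sub>m 0 r *\<^sub>v a + 0\<^sub>m 0 s *\<^sub>v b)"
    using A As by (simp add: Let_def four_block_mat_mult_vec[OF A As zero_carrier_mat zero_carrier_mat a b])
  also have "\<dots> = A *\<^sub>v a + hcat nr As *\<^sub>v b"
    using A As by (intro eq_vecI) auto
  finally show ?thesis .
qed

text \<open>Block multiplication: only products of blocks with equal index occur. The coordinatewise
  form makes the right-hand side a list sum of complex numbers, which can later be regrouped by kind
  of station and by user.\<close>

lemma hcat_mult_vcat_index:
  assumes "\<And>x. x \<in> set xs \<Longrightarrow> f x \<in> carrier_mat nr (d x)"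
    and "\<And>x. x \<in> set xs \<Longrightarrow> g x \<in> carrier_mat (d x) nc"
    and u: "u \<in> carrier_vec nc" and i: "i < nr"
  shows "(hcat nr (map f xs) *\<^sub>v (vcat nc (map g xs) *\<^sub>v u)) $ i = (\<Sum>x\<leftarrow>xs. (f x *\<^sub>v (g x *\<^sub>v u)) $ i)"
  using assms(1,2)
proof (induction xs)
  case Nil
  then show ?case using i by (simp add: vcat_def scalar_prod_def)
next
  case (Cons x xs)
  have f: "f x \<in> carrier_mat nr (d x)" and g: "g x \<in> carrier_mat (d x) nc" using Cons.prems by auto
  have H: "hcat nr (map f xs) \<in> carrier_mat nr (\<Sum>x\<leftarrow>xs. d x)"
    using Cons.prems by (intro hcat_map_carrier) auto
  have V: "vcat nc (map g xs) \<in> carrier_mat (\<Sum>x\<leftarrow>xs. d x) nc"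
    using Cons.prems by (intro vcat_map_carrier) auto
  have "vcat nc (map g (x # xs)) *\<^sub>v u = (g x *\<^sub>v u) @\<^sub>v (vcat nc (map g xs) *\<^sub>v u)"
    by (simp add: vcat_Cons[OF g V] mat_mult_append[OF g V u])
  then have "hcat nr (map f (x # xs)) *\<^sub>v (vcat nc (map g (x # xs)) *\<^sub>v u)
      = f x *\<^sub>v (g x *\<^sub>v u) + hcat nr (map f xs) *\<^sub>v (vcat nc (map g xs) *\<^sub>v u)"
    using hcat_Cons_mult_append[OF f H, of "g x *\<^sub>v u" "vcat nc (map g xs) *\<^sub>v u"] g V u
    by (simp del: hcat.simps)
  then show ?case using Cons.IH Cons.prems f H i by (simp del: hcat.simps)
qed

section \<open>Block diagonal matrices acting on block columns, and their sums\<close>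

lemma diag_block_map_carrier:
  assumes "\<And>x. x \<in> set xs \<Longrightarrow> D x \<in> carrier_mat (d x) (d x)"
  shows "diag_block_mat (map D xs) \<in> carrier_mat (\<Sum>x\<leftarrow>xs. d x) (\<Sum>x\<leftarrow>xs. d x)"
proof -
  have "(\<Sum>x\<leftarrow>xs. dim_row (D x)) = (\<Sum>x\<leftarrow>xs. d x)" "(\<Sum>x\<leftarrow>xs. dim_col (D x)) = (\<Sum>x\<leftarrow>xs. d x)"
    using carrier_matD[OF assms] by (auto intro!: arg_cong[where f = sum_list])
  then show ?thesis by (intro carrier_matI) (simp_all add: dim_diag_block_mat comp_def)
qed

lemma diag_block_Cons:
  assumes "A \<in> carrier_mat n n" "diag_block_mat As \<in> carrier_mat m m"
  shows "diag_block_mat (A # As) = four_block_mat A (0\<^sub>m n m) (0\<^sub>m m n) (diag_block_mat As)"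
  using assms by (auto simp: Let_def)

lemma diag_block_mult_vcat:
  assumes "\<And>x. x \<in> set xs \<Longrightarrow> D x \<in> carrier_mat (d x) (d x)"
    and "\<And>x. x \<in> set xs \<Longrightarrow> g x \<in> carrier_mat (d x) nc"
  shows "diag_block_mat (map D xs) * vcat nc (map g xs) = vcat nc (map (\<lambda>x. D x * g x) xs)"
  using assms
proof (induction xs)
  case Nil
  then show ?case by (auto simp: vcat_def)
next
  case (Cons x xs)
  define s where "s = (\<Sum>x\<leftarrow>xs. d x)"
  have D: "D x \<in> carrier_mat (d x) (d x)" and g: "g x \<in> carrier_mat (d x) nc"
    using Cons.prems by auto
  have Dg: "D x * g x \<in> carrier_mat (d x) nc" by (rule mult_carrier_mat[OF D g])
  have DD: "diag_block_mat (map D xs) \<in> carrier_mat s s"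
    unfolding s_def using Cons.prems by (intro diag_block_map_carrier) auto
  have V: "vcat nc (map g xs) \<in> carrier_mat s nc"
    unfolding s_def using Cons.prems by (intro vcat_map_carrier) auto
  have V': "vcat nc (map (\<lambda>x. D x * g x) xs) \<in> carrier_mat s nc"
    unfolding s_def using Cons.prems by (intro vcat_map_carrier) (auto intro: mult_carrier_mat)
  \<comment> \<open>A block column is a four-block matrix whose right blocks have no columns, so the
    four-block product formula applies.\<close>
  have "diag_block_mat (map D (x # xs)) * vcat nc (map g (x # xs))
      = four_block_mat (D x) (0\<^sub>m (d x) s) (0\<^sub>m s (d x)) (diag_block_mat (map D xs))
        * four_block_mat (g x) (0\<^sub>m (d x) 0) (vcat nc (map g xs)) (0\<^sub>m s 0)"
    using diag_block_Cons[OF D DD] vcat_Cons[OF g V] g V by (simp add: append_rows_def)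
  also have "\<dots> = four_block_mat (D x * g x) (0\<^sub>m (d x) 0) (diag_block_mat (map D xs) * vcat nc (map g xs)) (0\<^sub>m s 0)"
    by (subst mult_four_block_mat[OF D _ _ DD g _ V]) (use D DD g V in auto)
  also have "\<dots> = vcat nc (map (\<lambda>x. D x * g x) (x # xs))"
    using Cons vcat_Cons[OF Dg V'] D g V' by (simp add: append_rows_def)
  finally show ?case .
qed

text \<open>The Frobenius inner product is a sum over rows, and stacking matrices concatenates their
  rows.\<close>

lemma mtrace_vcat:
  assumes "\<And>x. x \<in> set xs \<Longrightarrow> f x \<in> carrier_mat (d x) nc"
    and "\<And>x. x \<in> set xs \<Longrightarrow> g x \<in> carrier_mat (d x) nc"
  shows "mtrace (vcat nc (map f xs) * mat_adjoint (vcat nc (map g xs)))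
    = (\<Sum>x\<leftarrow>xs. mtrace (f x * mat_adjoint (g x)))"
  using assms
proof (induction xs)
  case Nil
  then show ?case by (simp add: vcat_def mtrace_def)
next
  case (Cons x xs)
  define s where "s = (\<Sum>x\<leftarrow>xs. d x)"
  have f: "f x \<in> carrier_mat (d x) nc" and g: "g x \<in> carrier_mat (d x) nc" using Cons.prems by auto
  have F: "vcat nc (map f xs) \<in> carrier_mat s nc"
    unfolding s_def using Cons.prems by (intro vcat_map_carrier) auto
  have G: "vcat nc (map g xs) \<in> carrier_mat s nc"
    unfolding s_def using Cons.prems by (intro vcat_map_carrier) auto
  have split: "sum h {..<d x + s} = sum h {..<d x} + (\<Sum>i<s. h (d x + i))" for h :: "nat \<Rightarrow> complex"
    by (induction s) (simp_all add: add.assoc)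
  have "mtrace (vcat nc (map f (x # xs)) * mat_adjoint (vcat nc (map g (x # xs))))
      = (\<Sum>i<d x + s. \<Sum>j<nc. (f x @\<^sub>r vcat nc (map f xs)) $$ (i, j) * cnj ((g x @\<^sub>r vcat nc (map g xs)) $$ (i, j)))"
    using vcat_Cons[OF f F] vcat_Cons[OF g G] mtrace_mult_adjoint[OF carrier_append_rows[OF f F] carrier_append_rows[OF g G]] by simp
  also have "\<dots> = (\<Sum>i<d x. \<Sum>j<nc. f x $$ (i, j) * cnj (g x $$ (i, j)))
      + (\<Sum>i<s. \<Sum>j<nc. vcat nc (map f xs) $$ (i, j) * cnj (vcat nc (map g xs) $$ (i, j)))"
    unfolding split using f g F G
    by (intro arg_cong2[where f = "(+)"] sum.cong) (simp_all add: append_rows_def)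
  also have "\<dots> = mtrace (f x * mat_adjoint (g x)) + (\<Sum>x\<leftarrow>xs. mtrace (f x * mat_adjoint (g x)))"
    using Cons by (simp add: mtrace_mult_adjoint[OF f g] mtrace_mult_adjoint[OF F G, symmetric])
  finally show ?case by simp
qed

text \<open>The left-hand side is the summand of one user in a generalized constraint, with weight
  \<open>D\<close> and stacked precoder \<open>g\<close>; it decouples into one trace per
  station.\<close>

lemma mtrace_diag_block_vcat:
  assumes D: "\<And>x. x \<in> set xs \<Longrightarrow> D x \<in> carrier_mat (d x) (d x)"
    and g: "\<And>x. x \<in> set xs \<Longrightarrow> g x \<in> carrier_mat (d x) nc"
  shows "mtrace (diag_block_mat (map D xs) * vcat nc (map g xs) * mat_adjoint (vcat nc (map g xs)))
    = (\<Sum>x\<leftarrow>xs. mtrace (D x * g x * mat_adjoint (g x)))"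
proof -
  have "diag_block_mat (map D xs) * vcat nc (map g xs) = vcat nc (map (\<lambda>x. D x * g x) xs)"
    using D g by (rule diag_block_mult_vcat)
  moreover have "D x * g x \<in> carrier_mat (d x) nc" if "x \<in> set xs" for x
    using D[OF that] g[OF that] by (rule mult_carrier_mat)
  ultimately show ?thesis using mtrace_vcat[of xs "\<lambda>x. D x * g x" d nc g] g by simp
qed

lemma mat_sum_carrier [simp]: "mat_sum n f I \<in> carrier_mat n n"
  by (simp add: mat_sum_def)

text \<open>Brings the sum over all constraints inside the blocks of a weight sum. The explicit
  dimension in \<open>mat_sum\<close> keeps the identity meaningful for an empty
  \<open>I\<close>.\<close>

lemma mat_sum_diag_block:
  assumes "\<And>a x. x \<in> set xs \<Longrightarrow> a \<in> I \<Longrightarrow> D a x \<in> carrier_mat (d x) (d x)"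
  shows "mat_sum (\<Sum>x\<leftarrow>xs. d x) (\<lambda>a. diag_block_mat (map (D a) xs)) I
    = diag_block_mat (map (\<lambda>x. mat_sum (d x) (\<lambda>a. D a x) I) xs)"
  using assms
proof (induction xs)
  case Nil
  then show ?case by (auto simp: mat_sum_def)
next
  case (Cons x xs)
  define s where "s = (\<Sum>x\<leftarrow>xs. d x)"
  have D: "D a x \<in> carrier_mat (d x) (d x)" if "a \<in> I" for a using Cons.prems that by auto
  have DD: "diag_block_mat (map (D a) xs) \<in> carrier_mat s s" if "a \<in> I" for a
    unfolding s_def using Cons.prems that by (intro diag_block_map_carrier) auto
  have IH: "mat_sum s (\<lambda>a. diag_block_mat (map (D a) xs)) I
    = diag_block_mat (map (\<lambda>x. mat_sum (d x) (\<lambda>a. D a x) I) xs)"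
    unfolding s_def using Cons by auto
  have "mat_sum (d x + s) (\<lambda>a. diag_block_mat (map (D a) (x # xs))) I
      = four_block_mat (mat_sum (d x) (\<lambda>a. D a x) I) (0\<^sub>m (d x) s) (0\<^sub>m s (d x))
          (mat_sum s (\<lambda>a. diag_block_mat (map (D a) xs)) I)" (is "?l = ?r")
  proof (rule eq_matI)
    fix i j assume ij: "i < dim_row ?r" "j < dim_col ?r"
    have "?l $$ (i, j) = (\<Sum>a\<in>I. four_block_mat (D a x) (0\<^sub>m (d x) s) (0\<^sub>m s (d x)) (diag_block_mat (map (D a) xs)) $$ (i, j))"
      using ij by (auto simp: mat_sum_def diag_block_Cons[OF D DD] simp del: diag_block_mat.simps intro!: sum.cong)
    also have "\<dots> = (\<Sum>a\<in>I. if i < d x then if j < d x then D a x $$ (i, j) else 0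
       else if j < d x then 0 else diag_block_mat (map (D a) xs) $$ (i - d x, j - d x))"
    proof (rule sum.cong)
      fix a assume "a \<in> I"
      show "four_block_mat (D a x) (0\<^sub>m (d x) s) (0\<^sub>m s (d x)) (diag_block_mat (map (D a) xs)) $$ (i, j)
        = (if i < d x then if j < d x then D a x $$ (i, j) else 0
       else if j < d x then 0 else diag_block_mat (map (D a) xs) $$ (i - d x, j - d x))"
        using ij D[OF \<open>a \<in> I\<close>] DD[OF \<open>a \<in> I\<close>] by (auto simp: mat_sum_def)
    qed simp
    also have "\<dots> = ?r $$ (i, j)" using ij by (auto simp: mat_sum_def)
    finally show "?l $$ (i, j) = ?r $$ (i, j)" .
  qed (auto simp: mat_sum_def)
  also have "\<dots> = diag_block_mat (map (\<lambda>x. mat_sum (d x) (\<lambda>a. D a x) I) (x # xs))"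
    unfolding IH list.map
    by (rule diag_block_Cons[symmetric]) (auto simp: s_def intro!: diag_block_map_carrier)
  finally show ?case by (simp add: s_def)
qed

lemma diag_block_add:
  fixes A B :: "'a \<Rightarrow> complex mat"
  assumes "\<And>x. x \<in> set xs \<Longrightarrow> A x \<in> carrier_mat (d x) (d x)"
    and "\<And>x. x \<in> set xs \<Longrightarrow> B x \<in> carrier_mat (d x) (d x)"
  shows "diag_block_mat (map A xs) + diag_block_mat (map B xs)
    = diag_block_mat (map (\<lambda>x. A x + B x) xs)"
  using assms
proof (induction xs)
  case (Cons x xs)
  define s where "s = (\<Sum>x\<leftarrow>xs. d x)"
  have *: "diag_block_mat (map A xs) \<in> carrier_mat s s" "diag_block_mat (map B xs) \<in> carrier_mat s s"
    "diag_block_mat (map (\<lambda>x. A x + B x) xs) \<in> carrier_mat s s"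
    unfolding s_def using Cons.prems by (intro diag_block_map_carrier; auto)+
  have "0\<^sub>m p q + 0\<^sub>m p q = (0\<^sub>m p q :: complex mat)" for p q by auto
  moreover have "A x \<in> carrier_mat (d x) (d x)" "B x \<in> carrier_mat (d x) (d x)" using Cons.prems by auto
  ultimately show ?case
    using Cons * diag_block_Cons[of "A x" "d x" "map A xs" s] diag_block_Cons[of "B x" "d x" "map B xs" s]
      diag_block_Cons[of "A x + B x" "d x" "map (\<lambda>x. A x + B x) xs" s]
    by (simp add: add_four_block_mat[of _ "d x" "d x" _ s _ s])
qed auto

section \<open>Definiteness of block diagonal matrices\<close>

lemma mat_adjoint_block_diag:
  fixes A B :: "complex mat"
  assumes "A \<in> carrier_mat n n" "B \<in> carrier_mat m m"
  shows "mat_adjoint (four_block_mat A (0\<^sub>m n m) (0\<^sub>m m n) B)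
    = four_block_mat (mat_adjoint A) (0\<^sub>m n m) (0\<^sub>m m n) (mat_adjoint B)"
  by (rule eq_matI) (use assms in \<open>auto simp: mat_adjoint_index\<close>)

text \<open>Allows \<open>hermitian_block_diag\<close> to pass from self-adjointness of the whole
  matrix to that of each block.\<close>

lemma block_diag_inj:
  assumes "A \<in> carrier_mat n n" "B \<in> carrier_mat m m" "A' \<in> carrier_mat n n" "B' \<in> carrier_mat m m"
    and eq: "four_block_mat A (0\<^sub>m n m) (0\<^sub>m m n) B = four_block_mat A' (0\<^sub>m n m) (0\<^sub>m m n) B'"
  shows "A = A' \<and> B = B'"
proof
  have ent: "four_block_mat A (0\<^sub>m n m) (0\<^sub>m m n) B $$ p = four_block_mat A' (0\<^sub>m n m) (0\<^sub>m m n) B' $$ p" for p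
    using eq by simp
  show "A = A'"
  proof (rule eq_matI)
    show "A $$ (i, j) = A' $$ (i, j)" if "i < dim_row A'" "j < dim_col A'" for i j
      using ent[of "(i, j)"] that assms(1-4) by auto
  qed (use assms in auto)
  show "B = B'"
  proof (rule eq_matI)
    show "B $$ (i, j) = B' $$ (i, j)" if "i < dim_row B'" "j < dim_col B'" for i j
      using ent[of "(n + i, n + j)"] that assms(1-4) by auto
  qed (use assms in auto)
qed

lemma hermitian_block_diag:
  assumes "A \<in> carrier_mat n n" "B \<in> carrier_mat m m"
  shows "hermitian (n + m) (four_block_mat A (0\<^sub>m n m) (0\<^sub>m m n) B) \<longleftrightarrow> hermitian n A \<and> hermitian m B"
  using assms block_diag_inj[of "mat_adjoint A" n "mat_adjoint B" m A B]
  by (auto simp: hermitian_def mat_adjoint_block_diag)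

lemma block_diag_form:
  fixes A B :: "complex mat"
  assumes A: "A \<in> carrier_mat n n" and B: "B \<in> carrier_mat m m"
    and x: "x \<in> carrier_vec n" and y: "y \<in> carrier_vec m"
  shows "(four_block_mat A (0\<^sub>m n m) (0\<^sub>m m n) B *\<^sub>v (x @\<^sub>v y)) \<bullet>c (x @\<^sub>v y) = (A *\<^sub>v x) \<bullet>c x + (B *\<^sub>v y) \<bullet>c y"
proof -
  have "conjugate (x @\<^sub>v y) = conjugate x @\<^sub>v conjugate y" by (rule eq_vecI) auto
  then show ?thesis
    using assms by (simp add: mult_mat_vec_split[OF A B x y] scalar_prod_append[of _ n _ m])
qed

text \<open>Lets definiteness be tested on concatenated vectors, on which the form of a block
  diagonal matrix is additive.\<close>

lemma all_carrier_vec_append: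
  "(\<forall>z\<in>carrier_vec (n + m). Q z) \<longleftrightarrow> (\<forall>x\<in>carrier_vec n. \<forall>y\<in>carrier_vec m. Q (x @\<^sub>v y))"
  by (metis append_carrier_vec vec_first_carrier vec_last_carrier vec_first_last_append)

lemma append_eq_zero_vec:
  fixes x y :: "complex vec"
  assumes "x \<in> carrier_vec n" "y \<in> carrier_vec m"
  shows "x @\<^sub>v y = 0\<^sub>v (n + m) \<longleftrightarrow> x = 0\<^sub>v n \<and> y = 0\<^sub>v m"
proof -
  have "0\<^sub>v (n + m) = 0\<^sub>v n @\<^sub>v (0\<^sub>v m :: complex vec)" by (rule eq_vecI) auto
  then show ?thesis using append_vec_eq[OF assms(1), of "0\<^sub>v n" y "0\<^sub>v m"] by simp
qed

text \<open>Inserting the zero vector in one half isolates the form of the other block; conversely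
  the two nonnegative forms add up.\<close>

lemma positive_semidefinite_block_diag:
  assumes A: "A \<in> carrier_mat n n" and B: "B \<in> carrier_mat m m"
  shows "positive_semidefinite (n + m) (four_block_mat A (0\<^sub>m n m) (0\<^sub>m m n) B)
    \<longleftrightarrow> positive_semidefinite n A \<and> positive_semidefinite m B"
proof -
  let ?a = "\<lambda>x. Re ((A *\<^sub>v x) \<bullet>c x)" and ?b = "\<lambda>y. Re ((B *\<^sub>v y) \<bullet>c y)"
  have z: "?a (0\<^sub>v n) = 0" "?b (0\<^sub>v m) = 0" using A B by (auto simp: scalar_prod_def)
  have "(\<forall>x\<in>carrier_vec n. \<forall>y\<in>carrier_vec m. 0 \<le> ?a x + ?b y)
      \<longleftrightarrow> (\<forall>x\<in>carrier_vec n. 0 \<le> ?a x) \<and> (\<forall>y\<in>carrier_vec m. 0 \<le> ?b y)"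
    using z by (metis add.right_neutral add_0 add_nonneg_nonneg zero_carrier_vec)
  then show ?thesis
    unfolding positive_semidefinite_def hermitian_block_diag[OF A B] all_carrier_vec_append
    by (auto simp: block_diag_form[OF A B])
qed

text \<open>A nonzero concatenation may have one zero half. The form of that half is 0, and strict
  positivity then comes from the other half alone.\<close>

lemma positive_definite_block_diag:
  assumes A: "A \<in> carrier_mat n n" and B: "B \<in> carrier_mat m m"
  shows "positive_definite (n + m) (four_block_mat A (0\<^sub>m n m) (0\<^sub>m m n) B)
    \<longleftrightarrow> positive_definite n A \<and> positive_definite m B"
proof -
  let ?a = "\<lambda>x. Re ((A *\<^sub>v x) \<bullet>c x)" and ?b = "\<lambda>y. Re ((B *\<^sub>v y) \<bullet>c y)"
  have z: "?a (0\<^sub>v n) = 0" "?b (0\<^sub>v m) = 0" using A B by (auto simp: scalar_prod_def)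
  have "(\<forall>x\<in>carrier_vec n. \<forall>y\<in>carrier_vec m. \<not> (x = 0\<^sub>v n \<and> y = 0\<^sub>v m) \<longrightarrow> 0 < ?a x + ?b y)
      \<longleftrightarrow> (\<forall>x\<in>carrier_vec n. x \<noteq> 0\<^sub>v n \<longrightarrow> 0 < ?a x) \<and> (\<forall>y\<in>carrier_vec m. y \<noteq> 0\<^sub>v m \<longrightarrow> 0 < ?b y)"
    using z by (metis add.right_neutral add_0 add_pos_pos zero_carrier_vec)
  then show ?thesis
    unfolding positive_definite_def hermitian_block_diag[OF A B] all_carrier_vec_append
    by (auto simp: block_diag_form[OF A B] append_eq_zero_vec)
qed

lemma definite_diag_block:
  assumes "\<And>x. x \<in> set xs \<Longrightarrow> D x \<in> carrier_mat (d x) (d x)"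
  shows "(positive_semidefinite (\<Sum>x\<leftarrow>xs. d x) (diag_block_mat (map D xs))
        \<longleftrightarrow> (\<forall>x\<in>set xs. positive_semidefinite (d x) (D x)))
      \<and> (positive_definite (\<Sum>x\<leftarrow>xs. d x) (diag_block_mat (map D xs))
        \<longleftrightarrow> (\<forall>x\<in>set xs. positive_definite (d x) (D x)))"
  using assms
proof (induction xs)
  case Nil
  \<comment> \<open>In dimension 0 the zero vector is the only one, so the empty block matrix has
    both properties.\<close>
  have "mat_adjoint (0\<^sub>m 0 0) = (0\<^sub>m 0 0 :: complex mat)" by (rule eq_matI) auto
  then show ?case
    by (auto simp: positive_definite_def positive_semidefinite_def hermitian_def scalar_prod_def)
next
  case (Cons x xs)
  have D: "D x \<in> carrier_mat (d x) (d x)" using Cons.prems by auto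
  have DD: "diag_block_mat (map D xs) \<in> carrier_mat (\<Sum>x\<leftarrow>xs. d x) (\<Sum>x\<leftarrow>xs. d x)"
    using Cons.prems by (intro diag_block_map_carrier) auto
  show ?case
    using Cons.IH Cons.prems positive_semidefinite_block_diag[OF D DD]
      positive_definite_block_diag[OF D DD] diag_block_Cons[OF D DD]
    by (simp del: diag_block_mat.simps)
qed

section \<open>Gram matrices and spectral projections\<close>

lemma gram_form:
  fixes A :: "complex mat"
  assumes A: "A \<in> carrier_mat n m" and x: "x \<in> carrier_vec m"
  shows "Re ((mat_adjoint A * A *\<^sub>v x) \<bullet>c x) = norm_sq (A *\<^sub>v x)"
proof -
  have "(mat_adjoint A * A *\<^sub>v x) \<bullet>c x = (mat_adjoint A *\<^sub>v (A *\<^sub>v x)) \<bullet>c x"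
    using A x by (simp add: assoc_mult_mat_vec[of _ m n _ m])
  also have "\<dots> = (A *\<^sub>v x) \<bullet>c (A *\<^sub>v x)"
    using inner_mat_adjoint[of "mat_adjoint A" m n "A *\<^sub>v x" x] A x by simp
  finally show ?thesis by (simp add: inner_self_Re)
qed

lemma gram_carrier: "A \<in> carrier_mat n m \<Longrightarrow> mat_adjoint A * (A :: complex mat) \<in> carrier_mat m m"
  by (rule mult_carrier_mat[OF mat_adjoint_carrier])

lemma gram_hermitian: "A \<in> carrier_mat n m \<Longrightarrow> hermitian m (mat_adjoint A * A)"
  by (simp add: gram_carrier hermitian_def mat_adjoint_mult[of "mat_adjoint A" m n A m])

lemma positive_semidefinite_gram:
  "A \<in> carrier_mat n m \<Longrightarrow> positive_semidefinite m (mat_adjoint A * A)"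
  by (simp add: positive_semidefinite_def gram_hermitian gram_form norm_sq_nonneg)

text \<open>The form of a Gram matrix at \<open>x\<close> is the squared norm of \<open>A x\<close>,
  which vanishes exactly on the kernel of \<open>A\<close>.\<close>

lemma positive_definite_gram_iff:
  assumes "A \<in> carrier_mat n m"
  shows "positive_definite m (mat_adjoint A * A)
    \<longleftrightarrow> (\<forall>x\<in>carrier_vec m. A *\<^sub>v x = 0\<^sub>v n \<longrightarrow> x = 0\<^sub>v m)"
  using assms norm_sq_pos_iff[of "A *\<^sub>v _" n]
  by (auto simp: positive_definite_def gram_hermitian gram_form)

lemma positive_definite_one: "positive_definite n (1\<^sub>m n)"
proof -
  have 1: "mat_adjoint (1\<^sub>m n) = (1\<^sub>m n :: complex mat)"
    by (rule eq_matI) (auto simp: mat_adjoint_index)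
  then show ?thesis using positive_definite_gram_iff[of "1\<^sub>m n" n n] by simp
qed

text \<open>If some weight vanishes, the corresponding column of \<open>V\<close> lies in the kernel.\<close>

lemma spectral_projection_injective_iff:
  fixes c :: "nat \<Rightarrow> complex"
  assumes V: "unitary_mat n V"
  shows "(\<forall>x\<in>carrier_vec n. V * mat_diag n c * mat_adjoint V *\<^sub>v x = 0\<^sub>v n \<longrightarrow> x = 0\<^sub>v n)
    \<longleftrightarrow> (\<forall>u<n. c u \<noteq> 0)"
proof -
  have Vc: "V \<in> carrier_mat n n" and VV: "mat_adjoint V * V = 1\<^sub>m n" "V * mat_adjoint V = 1\<^sub>m n"
    using V by (auto simp: unitary_mat_def)
  have aV: "mat_adjoint V \<in> carrier_mat n n" using Vc by simp
  have Dc: "mat_diag n c \<in> carrier_mat n n" by simp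
  have cancel: "mat_adjoint V *\<^sub>v (V *\<^sub>v x) = x" "V *\<^sub>v (mat_adjoint V *\<^sub>v x) = x" if "x \<in> carrier_vec n" for x
    using that VV assoc_mult_mat_vec[OF aV Vc that] assoc_mult_mat_vec[OF Vc aV that] by auto
  have P: "V * mat_diag n c * mat_adjoint V *\<^sub>v x = V *\<^sub>v (mat_diag n c *\<^sub>v (mat_adjoint V *\<^sub>v x))"
    if "x \<in> carrier_vec n" for x
    using assoc_mult_mat_vec[OF mult_carrier_mat[OF Vc Dc] aV that]
      assoc_mult_mat_vec[OF Vc Dc mult_mat_vec_carrier[OF aV that]] by simp
  have zero: "A *\<^sub>v 0\<^sub>v n = 0\<^sub>v n" if "A \<in> carrier_mat n n" for A :: "complex mat"
    using that by (intro eq_vecI) auto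
  have diag: "(mat_diag n c *\<^sub>v y) $ u = c u * y $ u" if "y \<in> carrier_vec n" "u < n" for y u
    using that by (simp add: mat_diag_def scalar_prod_def if_distrib[of "\<lambda>z. z * _"] cong: if_cong)
  show ?thesis
  proof (intro iffI ballI allI impI)
    fix u assume *: "\<forall>x\<in>carrier_vec n. V * mat_diag n c * mat_adjoint V *\<^sub>v x = 0\<^sub>v n \<longrightarrow> x = 0\<^sub>v n"
      and u: "u < n"
    let ?x = "V *\<^sub>v unit_vec n u"
    have x: "?x \<in> carrier_vec n" using Vc by simp
    show "c u \<noteq> 0"
    proof
      assume "c u = 0"
      then have "mat_diag n c *\<^sub>v unit_vec n u = 0\<^sub>v n"
        using diag[of "unit_vec n u"] carrier_matD[OF Dc] u
        by (intro eq_vecI) (auto simp: index_unit_vec simp del: index_mult_mat_vec)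
      then have "?x = 0\<^sub>v n" using * x P[OF x] by (simp add: cancel zero Vc)
      then have "unit_vec n u = (0\<^sub>v n :: complex vec)"
        using cancel(1)[of "unit_vec n u"] zero[OF aV] by simp
      then show False using u by (metis index_unit_vec(1) index_zero_vec(1) zero_neq_one)
    qed
  next
    fix x assume c: "\<forall>u<n. c u \<noteq> 0" and x: "x \<in> carrier_vec n"
      and 0: "V * mat_diag n c * mat_adjoint V *\<^sub>v x = 0\<^sub>v n"
    have y: "mat_adjoint V *\<^sub>v x \<in> carrier_vec n" by (rule mult_mat_vec_carrier[OF aV x])
    \<comment> \<open>Applying the adjoint of \<open>V\<close> removes the outer factor; what
      remains is a diagonal system for the coordinates of \<open>x\<close> in the basis of columns
      of \<open>V\<close>.\<close>
    have "mat_diag n c *\<^sub>v (mat_adjoint V *\<^sub>v x) = 0\<^sub>v n"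
      using cancel(1)[of "mat_diag n c *\<^sub>v (mat_adjoint V *\<^sub>v x)"] 0 P[OF x] zero[OF aV]
      by (metis Dc mult_mat_vec_carrier y)
    then have "(mat_adjoint V *\<^sub>v x) $ u = 0" if "u < n" for u
      using c diag[OF y that] that by simp
    then have "mat_adjoint V *\<^sub>v x = 0\<^sub>v n"
      using carrier_vecD[OF y] by (intro eq_vecI) (simp_all del: index_mult_mat_vec dim_mult_mat_vec)
    then show "x = 0\<^sub>v n" using cancel(2)[OF x] zero[OF Vc] by simp
  qed
qed

section \<open>Cyclicity of the trace\<close>

lemma mtrace_comm:
  assumes "A \<in> carrier_mat n m" "B \<in> carrier_mat m n"
  shows "mtrace (A * B) = mtrace (B * A)"
proof -
  have "mtrace (A * B) = (\<Sum>i<n. \<Sum>j<m. A $$ (i, j) * B $$ (j, i))"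
    using assms by (simp add: mtrace_def scalar_prod_def lessThan_atLeast0)
  also have "\<dots> = (\<Sum>j<m. \<Sum>i<n. A $$ (i, j) * B $$ (j, i))" by (rule sum.swap)
  also have "\<dots> = mtrace (B * A)"
    using assms by (simp add: mtrace_def scalar_prod_def lessThan_atLeast0 mult.commute)
  finally show ?thesis .
qed

text \<open>Links three shapes of the radar power: the one in the power constraint, the Frobenius
  square of \<open>P * F\<close> produced by second moments, and the weighted trace of the
  generalized constraint.\<close>

lemma mtrace_gram_mult:
  assumes P: "P \<in> carrier_mat n n" and F: "F \<in> carrier_mat n d"
  shows "mtrace (P * F * mat_adjoint F * mat_adjoint P) = mtrace (P * F * mat_adjoint (P * F))"
    and "mtrace (mat_adjoint P * P * F * mat_adjoint F) = mtrace (P * F * mat_adjoint F * mat_adjoint P)"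
proof -
  have aP: "mat_adjoint P \<in> carrier_mat n n" and aF: "mat_adjoint F \<in> carrier_mat d n"
    and PF: "P * F \<in> carrier_mat n d" using P F by auto
  show "mtrace (P * F * mat_adjoint F * mat_adjoint P) = mtrace (P * F * mat_adjoint (P * F))"
    using assoc_mult_mat[OF PF aF aP] by (simp add: mat_adjoint_mult[OF P F])
  have "mat_adjoint P * P * F * mat_adjoint F = mat_adjoint P * (P * F * mat_adjoint F)"
    using assoc_mult_mat[OF aP P F] assoc_mult_mat[OF aP PF aF] by simp
  then show "mtrace (mat_adjoint P * P * F * mat_adjoint F) = mtrace (P * F * mat_adjoint F * mat_adjoint P)"
    using mtrace_comm[OF aP mult_carrier_mat[OF PF aF]] by simp
qed

lemma mtrace_zero [simp]: "mtrace (0\<^sub>m n n) = 0"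
  by (simp add: mtrace_def)

lemma mtrace_zero_mult:
  assumes "F \<in> carrier_mat n d"
  shows "mtrace (0\<^sub>m n n * F * mat_adjoint F) = 0"
proof -
  have "0\<^sub>m n n * F = 0\<^sub>m n d" using assms by simp
  moreover have "0\<^sub>m n d * mat_adjoint F = 0\<^sub>m n n" by (rule left_mult_zero_mat[OF mat_adjoint_carrier[OF assms]])
  ultimately show ?thesis by simp
qed

section \<open>Linear combinations of symbol vectors and their expected power\<close>

lemma mult_finsum_vec:
  fixes A :: "complex mat"
  assumes I: "finite I" and A: "A \<in> carrier_mat r n" and f: "\<And>k. k \<in> I \<Longrightarrow> f k \<in> carrier_vec n"
  shows "A *\<^sub>v finsum_vec TYPE(complex) n f I = finsum_vec TYPE(complex) r (\<lambda>k. A *\<^sub>v f k) I"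
  using I f
proof (induction I)
  case empty
  then show ?case using A by (intro eq_vecI) (auto simp: finsum_vec_empty)
next
  case (insert k I)
  have f: "f \<in> I \<rightarrow> carrier_vec n" "f k \<in> carrier_vec n" using insert.prems by auto
  have Af: "(\<lambda>k. A *\<^sub>v f k) \<in> I \<rightarrow> carrier_vec r" "A *\<^sub>v f k \<in> carrier_vec r"
    using A insert.prems by (auto intro: mult_mat_vec_carrier)
  show ?case
    using insert finsum_vec_closed[OF f(1)]
    by (simp add: finsum_vec_insert[OF insert.hyps f] finsum_vec_insert[OF insert.hyps Af]
        mult_add_distrib_mat_vec[OF A f(2)])
qed

text \<open>Each coordinate of the combination is a scalar combination of the orthonormal symbols,
  with coefficients from one row of the matrices \<open>G k\<close>. Parseval and summation over the
  rows give squared Frobenius norms. Independence is stated for all of \<open>J\<close>, while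
  \<open>I\<close> will be the set of users served by one station.\<close>

lemma expected_norm_sq_finsum_vec:
  assumes W: "prob_space W" and I: "finite I" "I \<subseteq> J"
    and X: "\<And>k. k \<in> J \<Longrightarrow> std_complex_normal_vec W (d k) (X k)"
    and ind: "prob_space.indep_vars W (\<lambda>k. cspace (d k)) (\<lambda>k \<omega>. vec_fun (d k) (X k \<omega>)) J"
    and G: "\<And>k. k \<in> I \<Longrightarrow> G k \<in> carrier_mat n (d k)"
  shows "complex_of_real (LINT \<omega>|W. norm_sq (finsum_vec TYPE(complex) n (\<lambda>k. G k *\<^sub>v X k \<omega>) I))
    = (\<Sum>k\<in>I. mtrace (G k * mat_adjoint (G k)))"
proof -
  \<comment> \<open>All scalar symbols form one family, indexed by pairs of a user and a stream of
    that user.\<close>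
  define K where "K = (SIGMA k:I. {..<d k})"
  define z where "z = (\<lambda>(k, j) \<omega>. X k \<omega> $ j)"
  have K: "finite K" using I by (simp add: K_def)
  have int: "integrable W (\<lambda>\<omega>. z a \<omega> * cnj (z b \<omega>))"
    and orth: "(\<integral>\<omega>. z a \<omega> * cnj (z b \<omega>) \<partial>W) = (if a = b then 1 else 0)" if ab: "a \<in> K" "b \<in> K" for a b
  proof -
    obtain k i where a: "a = (k, i)" "k \<in> J" "i < d k" using ab(1) I(2) by (auto simp: K_def)
    obtain k' j where b: "b = (k', j)" "k' \<in> J" "j < d k'" using ab(2) I(2) by (auto simp: K_def)
    have "integrable W (\<lambda>\<omega>. z a \<omega> * cnj (z b \<omega>)) \<and>
      (\<integral>\<omega>. z a \<omega> * cnj (z b \<omega>) \<partial>W) = (if a = b then 1 else 0)"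
    proof (cases "k = k'")
      case True
      then show ?thesis
        using a b std_complex_normal_vec_integrable_prod[OF W X[OF a(2)] a(3)]
          std_complex_normal_vec_covariance[OF W X[OF a(2)] a(3)] by (simp add: z_def)
    next
      case False
      then show ?thesis
        using indep_std_complex_normal_vec_covariance[OF W a(2) b(2) False X ind a(3) b(3)] a b
        by (simp add: z_def)
    qed
    then show "integrable W (\<lambda>\<omega>. z a \<omega> * cnj (z b \<omega>))"
      "(\<integral>\<omega>. z a \<omega> * cnj (z b \<omega>) \<partial>W) = (if a = b then 1 else 0)" by auto
  qed
  let ?c = "\<lambda>i (k, j). G k $$ (i, j)"
  \<comment> \<open>The vectors are known to have the right dimension only on the sample space,
    which is all that equality of the integrals asks for.\<close>
  have norm: "norm_sq (finsum_vec TYPE(complex) n (\<lambda>k. G k *\<^sub>v X k \<omega>) I)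
      = (\<Sum>i<n. (cmod (\<Sum>a\<in>K. ?c i a * z a \<omega>))\<^sup>2)" if "\<omega> \<in> space W" for \<omega>
  proof -
    have Xc: "X k \<omega> \<in> carrier_vec (d k)" if "k \<in> I" for k
      using X[of k] that I(2) \<open>\<omega> \<in> space W\<close> by (auto simp: std_complex_normal_vec_def)
    have GX: "(\<lambda>k. G k *\<^sub>v X k \<omega>) \<in> I \<rightarrow> carrier_vec n"
      using G Xc by (auto intro!: mult_mat_vec_carrier)
    have dim: "dim_vec (finsum_vec TYPE(complex) n (\<lambda>k. G k *\<^sub>v X k \<omega>) I) = n"
      using finsum_vec_closed[OF GX] by auto
    have "finsum_vec TYPE(complex) n (\<lambda>k. G k *\<^sub>v X k \<omega>) I $ i = (\<Sum>a\<in>K. ?c i a * z a \<omega>)" if "i < n" for i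
    proof -
      have "finsum_vec TYPE(complex) n (\<lambda>k. G k *\<^sub>v X k \<omega>) I $ i = (\<Sum>k\<in>I. (G k *\<^sub>v X k \<omega>) $ i)"
        by (rule index_finsum_vec[OF I(1) that GX])
      also have "\<dots> = (\<Sum>k\<in>I. \<Sum>j<d k. G k $$ (i, j) * X k \<omega> $ j)"
      proof (rule sum.cong)
        fix k assume k: "k \<in> I"
        show "(G k *\<^sub>v X k \<omega>) $ i = (\<Sum>j<d k. G k $$ (i, j) * X k \<omega> $ j)"
          using G[OF k] Xc[OF k] that by (simp add: scalar_prod_def lessThan_atLeast0)
      qed simp
      also have "\<dots> = (\<Sum>a\<in>K. ?c i a * z a \<omega>)"
        using I(1) unfolding K_def by (subst sum.Sigma) (auto simp: z_def intro!: sum.cong)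
      finally show ?thesis .
    qed
    then show ?thesis unfolding norm_sq_def dim by (intro sum.cong) simp_all
  qed
  have "(LINT \<omega>|W. norm_sq (finsum_vec TYPE(complex) n (\<lambda>k. G k *\<^sub>v X k \<omega>) I))
      = (LINT \<omega>|W. (\<Sum>i<n. (cmod (\<Sum>a\<in>K. ?c i a * z a \<omega>))\<^sup>2))"
    by (rule Bochner_Integration.integral_cong[OF refl norm])
  also have "\<dots> = (\<Sum>i<n. \<Sum>a\<in>K. (cmod (?c i a))\<^sup>2)"
    using integral_norm_sq_orthonormal[OF K int orth]
    by (subst Bochner_Integration.integral_sum) auto
  also have "\<dots> = (\<Sum>i<n. \<Sum>k\<in>I. \<Sum>j<d k. (cmod (G k $$ (i, j)))\<^sup>2)"
    using I(1) unfolding K_def by (subst sum.Sigma) (auto intro!: sum.cong)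
  also have "\<dots> = (\<Sum>k\<in>I. \<Sum>i<n. \<Sum>j<d k. (cmod (G k $$ (i, j)))\<^sup>2)" by (rule sum.swap)
  finally have "complex_of_real (LINT \<omega>|W. norm_sq (finsum_vec TYPE(complex) n (\<lambda>k. G k *\<^sub>v X k \<omega>) I))
      = (\<Sum>k\<in>I. \<Sum>i<n. \<Sum>j<d k. G k $$ (i, j) * cnj (G k $$ (i, j)))"
    by (simp only: of_real_sum complex_norm_square)
  then show ?thesis using mtrace_mult_adjoint[OF G G] by simp
qed

lemma mat_sum_zero: "mat_sum n (\<lambda>a. 0\<^sub>m n n) I = 0\<^sub>m n n"
  by (rule eq_matI) (auto simp: mat_sum_def)

text \<open>In the block of a fixed station, only the weight of that station is nonzero; this
  evaluates the sum over all stations.\<close>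

lemma mat_sum_delta:
  assumes "finite I" "a \<in> I" "A \<in> carrier_mat n n"
  shows "mat_sum n (\<lambda>b. if a = b then A else 0\<^sub>m n n) I = A"
proof (rule eq_matI)
  fix i j assume ij: "i < dim_row A" "j < dim_col A"
  have "(\<Sum>b\<in>I. (if a = b then A else 0\<^sub>m n n) $$ (i, j)) = (\<Sum>b\<in>I. if a = b then A $$ (i, j) else 0)"
    using ij assms(3) by (intro sum.cong) auto
  then show "mat_sum n (\<lambda>b. if a = b then A else 0\<^sub>m n n) I $$ (i, j) = A $$ (i, j)"
    using assms ij by (simp add: mat_sum_def)
qed (use assms in \<open>auto simp: mat_sum_def\<close>)

lemma diag_block_zero:
  "diag_block_mat (map (\<lambda>x. 0\<^sub>m (d x) (d x)) xs) = 0\<^sub>m (\<Sum>x\<leftarrow>xs. d x) (\<Sum>x\<leftarrow>xs. d x)"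
proof (induction xs)
  case (Cons x xs)
  then show ?case by (simp add: Let_def)
qed simp

section \<open>The channel with general constraints\<close>

text \<open>The station \<open>(o)\<^sub>k\<close> is a base station (\<open>Inl\<close>) or a radar (\<open>Inr\<close>).\<close>

definition stations :: "(nat \<Rightarrow> 'm list) \<Rightarrow> (nat \<Rightarrow> 'l list) \<Rightarrow> nat \<Rightarrow> ('m + 'l) list" where
  "stations bl rl k = map Inl (bl k) @ map Inr (rl k)"

definition station_dim :: "('l, 'm, 'w) pms \<Rightarrow> 'm + 'l \<Rightarrow> nat" where
  "station_dim S = case_sum (\<lambda>_. n_t S) (\<lambda>_. n_rad S)"

text \<open>The test whether \<open>k\<close> is served is moved into the block. Served and unserved
  users then have weights of the same block diagonal form.\<close>

definition radar_block :: "('l, 'm, 'w) pms \<Rightarrow> nat \<Rightarrow> 'l \<Rightarrow> 'm + 'l \<Rightarrow> complex mat" where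
  "radar_block S k l = case_sum (\<lambda>_. 0\<^sub>m (n_t S) (n_t S))
     (\<lambda>l'. if l' = l \<and> k \<in> radar_msgs S l then mat_adjoint (radar_proj S l) * radar_proj S l
       else 0\<^sub>m (n_rad S) (n_rad S))"

definition bs_block :: "('l, 'm, 'w) pms \<Rightarrow> nat \<Rightarrow> 'm \<Rightarrow> 'm + 'l \<Rightarrow> complex mat" where
  "bs_block S k m = case_sum
     (\<lambda>m'. if m' = m \<and> k \<in> bs_msgs S m then 1\<^sub>m (n_t S) else 0\<^sub>m (n_t S) (n_t S))
     (\<lambda>_. 0\<^sub>m (n_rad S) (n_rad S))"

section \<open>Stacked matrices, weight sums and definiteness\<close>

locale pms_listing =
  fixes S :: "('l, 'm, 'w) pms" and bl :: "nat \<Rightarrow> 'm list" and rl :: "nat \<Rightarrow> 'l list"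
  assumes pms: "mimo_ifc_pms S" and listing: "station_listing S bl rl"
begin

lemma finites: "finite (radars S)" "finite (base_stations S)" "finite (users S)"
  "l \<in> radars S \<Longrightarrow> finite (radar_msgs S l)" "m \<in> base_stations S \<Longrightarrow> finite (bs_msgs S m)"
  using pms by (auto simp: mimo_ifc_pms_def users_def dest: finite_subset)

lemma radar_proj_carrier:
  assumes "l \<in> radars S" shows "radar_proj S l \<in> carrier_mat (n_rad S) (n_rad S)"
proof -
  have "svd_V S l \<in> carrier_mat (n_rad S) (n_rad S)"
    using pms assms by (auto simp: mimo_ifc_pms_def is_svd_def unitary_mat_def)
  then show ?thesis
    unfolding radar_proj_def by (intro mult_carrier_mat[of _ _ "n_rad S"]) auto
qed

lemma chan_carrier:
  "k \<in> users S \<Longrightarrow> l \<in> radars S \<Longrightarrow> radar_chan S k l \<in> carrier_mat (n_r S) (n_rad S)"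
  "k \<in> users S \<Longrightarrow> m \<in> base_stations S \<Longrightarrow> bs_chan S k m \<in> carrier_mat (n_r S) (n_t S)"
  using pms by (auto simp: mimo_ifc_pms_def)

lemma set_lists:
  assumes "k \<in> users S"
  shows "distinct (bl k)" "set (bl k) = bs_of S k" "distinct (rl k)" "set (rl k) = radars_of S k"
  using listing assms by (auto simp: station_listing_def)

lemma stations_cases:
  assumes "k \<in> users S" "x \<in> set (stations bl rl k)"
  obtains m where "x = Inl m" "m \<in> base_stations S" "m \<in> bs_of S k" "k \<in> bs_msgs S m"
  | l where "x = Inr l" "l \<in> radars S" "l \<in> radars_of S k" "k \<in> radar_msgs S l"
  using assms(2) set_lists[OF assms(1)] by (auto simp: stations_def bs_of_def radars_of_def)

text \<open>The lists are distinct, so sums over them do not depend on the chosen order of the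
  stations.\<close>

lemma sum_stations:
  fixes h :: "'m + 'l \<Rightarrow> complex"
  assumes "k \<in> users S"
  shows "(\<Sum>x\<leftarrow>stations bl rl k. h x) = (\<Sum>m\<in>bs_of S k. h (Inl m)) + (\<Sum>l\<in>radars_of S k. h (Inr l))"
  using set_lists[OF assms] by (simp add: stations_def comp_def sum_list_distinct_conv_sum_set)

lemma sum_station_dim:
  assumes "k \<in> users S"
  shows "(\<Sum>x\<leftarrow>stations bl rl k. station_dim S x) = stacked_tx S k"
proof -
  have "length (bl k) = card (bs_of S k)" "length (rl k) = card (radars_of S k)"
    using set_lists[OF assms] distinct_card by metis+
  then show ?thesis
    by (simp add: stations_def station_dim_def stacked_tx_def comp_def sum_list_triv)
qed

lemma stacked_chan_eq:
  "stacked_chan S bl rl k j = hcat (n_r S)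
     (map (case_sum (bs_chan S k) (\<lambda>l. radar_chan S k l * radar_proj S l)) (stations bl rl j))"
  by (simp add: stacked_chan_def stations_def comp_def)

lemma stacked_precoder_eq:
  "stacked_precoder S bl rl Fr Fb k
    = vcat (streams S k) (map (case_sum (Fb k) (Fr k)) (stations bl rl k))"
  by (simp add: stacked_precoder_def stations_def comp_def)

lemma chan_block_carrier:
  assumes "k \<in> users S" "j \<in> users S" "x \<in> set (stations bl rl j)"
  shows "case_sum (bs_chan S k) (\<lambda>l. radar_chan S k l * radar_proj S l) x
    \<in> carrier_mat (n_r S) (station_dim S x)"
  by (rule stations_cases[OF assms(2,3)])
    (use assms(1) chan_carrier radar_proj_carrier in \<open>auto simp: station_dim_def intro!: mult_carrier_mat\<close>)

lemma stacked_chan_carrier: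
  assumes "k \<in> users S" "j \<in> users S"
  shows "stacked_chan S bl rl k j \<in> carrier_mat (n_r S) (stacked_tx S j)"
  unfolding stacked_chan_eq sum_station_dim[OF assms(2), symmetric]
  by (rule hcat_map_carrier) (rule chan_block_carrier[OF assms])

lemma radar_block_carrier:
  "l \<in> radars S \<Longrightarrow> radar_block S k l x \<in> carrier_mat (station_dim S x) (station_dim S x)"
  using gram_carrier[OF radar_proj_carrier]
  by (auto simp: radar_block_def station_dim_def split: sum.split)

lemma bs_block_carrier: "bs_block S k m x \<in> carrier_mat (station_dim S x) (station_dim S x)"
  by (auto simp: bs_block_def station_dim_def split: sum.split)

lemma stacked_weight_radar_eq:
  assumes "k \<in> users S"
  shows "stacked_weight_radar S bl rl k l = diag_block_mat (map (radar_block S k l) (stations bl rl k))"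
proof (cases "k \<in> radar_msgs S l")
  case True
  then show ?thesis
    by (simp add: stacked_weight_radar_def stations_def radar_block_def comp_def)
next
  case False
  then have "radar_block S k l = (\<lambda>x. 0\<^sub>m (station_dim S x) (station_dim S x))"
    by (auto simp: radar_block_def station_dim_def fun_eq_iff split: sum.split)
  then show ?thesis
    using False by (simp add: stacked_weight_radar_def diag_block_zero sum_station_dim[OF assms])
qed

lemma stacked_weight_bs_eq:
  assumes "k \<in> users S"
  shows "stacked_weight_bs S bl rl k m = diag_block_mat (map (bs_block S k m) (stations bl rl k))"
proof (cases "k \<in> bs_msgs S m")
  case True
  then show ?thesis
    by (simp add: stacked_weight_bs_def stations_def bs_block_def comp_def)
next
  case False
  then have "bs_block S k m = (\<lambda>x. 0\<^sub>m (station_dim S x) (station_dim S x))"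
    by (auto simp: bs_block_def station_dim_def fun_eq_iff split: sum.split)
  then show ?thesis
    using False by (simp add: stacked_weight_bs_def diag_block_zero sum_station_dim[OF assms])
qed

lemma stacked_weight_carrier:
  assumes "k \<in> users S"
  shows "l \<in> radars S \<Longrightarrow> stacked_weight_radar S bl rl k l \<in> carrier_mat (stacked_tx S k) (stacked_tx S k)"
    and "stacked_weight_bs S bl rl k m \<in> carrier_mat (stacked_tx S k) (stacked_tx S k)"
  unfolding stacked_weight_radar_eq[OF assms] stacked_weight_bs_eq[OF assms]
    sum_station_dim[OF assms, symmetric]
  by (auto intro!: diag_block_map_carrier radar_block_carrier bs_block_carrier)

text \<open>The diagonal block left at a station after all weight matrices of a user informed there
  have been added.\<close>

definition weight_block :: "'m + 'l \<Rightarrow> complex mat" where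
  "weight_block = case_sum (\<lambda>_. 1\<^sub>m (n_t S)) (\<lambda>l. mat_adjoint (radar_proj S l) * radar_proj S l)"

text \<open>Both sums of weights are taken inside the blocks. At each block the sum over stations of
  the other kind vanishes, and the sum over stations of the same kind has a single nonzero
  term.\<close>

lemma gc_weight_sum_eq:
  assumes k: "k \<in> users S"
  shows "gc_weight_sum (gc_of_pms S bl rl) k = diag_block_mat (map weight_block (stations bl rl k))"
proof -
  let ?d = "station_dim S" and ?xs = "stations bl rl k"
  let ?R = "\<lambda>x. mat_sum (?d x) (\<lambda>l. radar_block S k l x) (radars S)"
  let ?B = "\<lambda>x. mat_sum (?d x) (\<lambda>m. bs_block S k m x) (base_stations S)"
  have "mat_sum (stacked_tx S k) (stacked_weight_radar S bl rl k) (radars S) = diag_block_mat (map ?R ?xs)"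
    using mat_sum_diag_block[of ?xs "radars S" "radar_block S k" ?d] radar_block_carrier
    by (simp add: stacked_weight_radar_eq[OF k, abs_def] sum_station_dim[OF k])
  moreover have "mat_sum (stacked_tx S k) (stacked_weight_bs S bl rl k) (base_stations S) = diag_block_mat (map ?B ?xs)"
    using mat_sum_diag_block[of ?xs "base_stations S" "bs_block S k" ?d] bs_block_carrier
    by (simp add: stacked_weight_bs_eq[OF k, abs_def] sum_station_dim[OF k])
  ultimately have "gc_weight_sum (gc_of_pms S bl rl) k = diag_block_mat (map (\<lambda>x. ?R x + ?B x) ?xs)"
    using diag_block_add[of ?xs ?R ?d ?B] by (simp add: gc_weight_sum_def gc_of_pms_def)
  also have "map (\<lambda>x. ?R x + ?B x) ?xs = map weight_block ?xs"
  proof (rule map_cong[OF refl])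
    fix x assume x: "x \<in> set ?xs"
    show "?R x + ?B x = weight_block x"
      using k x
    proof (cases rule: stations_cases)
      case (1 m)
      have "?R x = 0\<^sub>m (n_t S) (n_t S)"
        using 1 mat_sum_zero by (simp add: radar_block_def station_dim_def)
      moreover have "(\<lambda>m'. bs_block S k m' x) = (\<lambda>m'. if m = m' then 1\<^sub>m (n_t S) else 0\<^sub>m (n_t S) (n_t S))"
        using 1 by (auto simp: bs_block_def fun_eq_iff)
      ultimately show ?thesis
        using 1 mat_sum_delta[OF finites(2) 1(2), of "1\<^sub>m (n_t S)" "n_t S"]
        by (simp add: weight_block_def station_dim_def)
    next
      case (2 l)
      let ?P = "mat_adjoint (radar_proj S l) * radar_proj S l"
      have P: "?P \<in> carrier_mat (n_rad S) (n_rad S)" by (rule gram_carrier[OF radar_proj_carrier[OF 2(2)]])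
      have "?B x = 0\<^sub>m (n_rad S) (n_rad S)"
        using 2 mat_sum_zero by (simp add: bs_block_def station_dim_def)
      moreover have "(\<lambda>l'. radar_block S k l' x) = (\<lambda>l'. if l = l' then ?P else 0\<^sub>m (n_rad S) (n_rad S))"
        using 2 by (auto simp: radar_block_def fun_eq_iff)
      ultimately show ?thesis
        using 2 P mat_sum_delta[OF finites(1) 2(2) P]
        by (simp add: weight_block_def station_dim_def)
    qed
  qed
  finally show ?thesis .
qed

lemma weight_block_carrier:
  assumes "k \<in> users S" "x \<in> set (stations bl rl k)"
  shows "weight_block x \<in> carrier_mat (station_dim S x) (station_dim S x)"
  by (rule stations_cases[OF assms])
    (use gram_carrier[OF radar_proj_carrier] in \<open>auto simp: weight_block_def station_dim_def\<close>)

lemma positive_semidefinite_gc_weight_sum: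
  assumes k: "k \<in> users S"
  shows "positive_semidefinite (stacked_tx S k) (gc_weight_sum (gc_of_pms S bl rl) k)"
proof -
  have one: "positive_semidefinite (n_t S) (1\<^sub>m (n_t S))"
    using positive_definite_one[of "n_t S"] inner_self_Re norm_sq_nonneg
    by (auto simp: positive_definite_def positive_semidefinite_def)
  have "positive_semidefinite (station_dim S x) (weight_block x)" if "x \<in> set (stations bl rl k)" for x
    by (rule stations_cases[OF k that])
      (auto simp: weight_block_def station_dim_def one intro: positive_semidefinite_gram radar_proj_carrier)
  then show ?thesis
    using definite_diag_block[of "stations bl rl k" weight_block "station_dim S", OF weight_block_carrier[OF k]]
    by (simp add: gc_weight_sum_eq[OF k] sum_station_dim[OF k])
qed

text \<open>In the basis of columns of \<open>svd_V S l\<close> the projection has weights 0 and 1,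
  and a weight is nonzero exactly when its singular value does not exceed the threshold. The index
  also covers the singular values padded with 0.\<close>

lemma positive_definite_radar_gram_iff:
  assumes "l \<in> radars S"
  shows "positive_definite (n_rad S) (mat_adjoint (radar_proj S l) * radar_proj S l)
    \<longleftrightarrow> (\<forall>u<n_rad S. sing_val S l u \<le> sv_threshold S)"
proof -
  have V: "unitary_mat (n_rad S) (svd_V S l)"
    using pms assms by (auto simp: mimo_ifc_pms_def is_svd_def)
  show ?thesis
    using positive_definite_gram_iff[OF radar_proj_carrier[OF assms]]
      spectral_projection_injective_iff[OF V, of "\<lambda>u. if sing_val S l u > sv_threshold S then 0 else 1"]
    by (auto simp: radar_proj_def not_less)
qed

lemma positive_definite_gc_weight_sum_iff:
  assumes k: "k \<in> users S"
  shows "positive_definite (stacked_tx S k) (gc_weight_sum (gc_of_pms S bl rl) k)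
    \<longleftrightarrow> (\<forall>l\<in>radars_of S k. \<forall>u<n_rad S. sing_val S l u \<le> sv_threshold S)"
proof -
  have "positive_definite (stacked_tx S k) (gc_weight_sum (gc_of_pms S bl rl) k)
      \<longleftrightarrow> (\<forall>x\<in>set (stations bl rl k). positive_definite (station_dim S x) (weight_block x))"
    using definite_diag_block[of "stations bl rl k" weight_block "station_dim S", OF weight_block_carrier[OF k]]
    by (simp add: gc_weight_sum_eq[OF k] sum_station_dim[OF k])
  also have "\<dots> \<longleftrightarrow> (\<forall>l\<in>radars_of S k. positive_definite (n_rad S) (mat_adjoint (radar_proj S l) * radar_proj S l))"
    using set_lists[OF k] positive_definite_one
    by (simp add: stations_def station_dim_def weight_block_def ball_Un)
  also have "\<dots> \<longleftrightarrow> (\<forall>l\<in>radars_of S k. \<forall>u<n_rad S. sing_val S l u \<le> sv_threshold S)"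
    using positive_definite_radar_gram_iff by (auto simp: radars_of_def)
  finally show ?thesis .
qed

lemma gc_model_gc_of_pms: "gc_model (gc_of_pms S bl rl)"
proof -
  have u: "gc_users (gc_of_pms S bl rl) = users S" by (simp add: gc_users_def gc_of_pms_def users_def)
  have "\<forall>k\<in>users S. streams S k \<le> min (stacked_tx S k) (n_r S)"
    using pms by (auto simp: mimo_ifc_pms_def stacked_tx_def add.commute)
  then show ?thesis
    using pms stacked_chan_carrier stacked_weight_carrier
    unfolding gc_model_def u by (auto simp: gc_of_pms_def mimo_ifc_pms_def)
qed

text \<open>Definiteness for all users tests only radars informed about someone. Any radar with a
  message is reached through a user in its message set, which passes from users to all
  radars.\<close>

lemma mimo_ifc_gc_iff:
  "mimo_ifc_gc (gc_of_pms S bl rl) \<longleftrightarrow> (\<forall>l\<in>radars S. \<forall>u<n_rad S. sing_val S l u \<le> sv_threshold S)"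
proof -
  have u: "gc_users (gc_of_pms S bl rl) = users S" by (simp add: gc_users_def gc_of_pms_def users_def)
  have tx: "gc_tx (gc_of_pms S bl rl) = stacked_tx S" by (simp add: gc_of_pms_def)
  have sub: "radar_msgs S l \<subseteq> users S" if "l \<in> radars S" for l
    using pms that by (auto simp: mimo_ifc_pms_def)
  have th: "0 \<le> sv_threshold S" using pms by (auto simp: mimo_ifc_pms_def)
  \<comment> \<open>A radar without messages has an empty stacked channel, hence only zero singular values.\<close>
  have emp: "sing_val S l u \<le> sv_threshold S" if "radar_msgs S l = {}" for l u
    using th that by (simp add: sing_val_def)
  have "mimo_ifc_gc (gc_of_pms S bl rl)
      \<longleftrightarrow> (\<forall>k\<in>users S. \<forall>l\<in>radars_of S k. \<forall>u<n_rad S. sing_val S l u \<le> sv_threshold S)"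
    using gc_model_gc_of_pms positive_definite_gc_weight_sum_iff by (simp add: mimo_ifc_gc_def u tx)
  also have "\<dots> \<longleftrightarrow> (\<forall>l\<in>radars S. \<forall>u<n_rad S. sing_val S l u \<le> sv_threshold S)"
  proof
    assume *: "\<forall>k\<in>users S. \<forall>l\<in>radars_of S k. \<forall>u<n_rad S. sing_val S l u \<le> sv_threshold S"
    show "\<forall>l\<in>radars S. \<forall>u<n_rad S. sing_val S l u \<le> sv_threshold S"
    proof (intro ballI allI impI)
      fix l u assume l: "l \<in> radars S" and u: "u < n_rad S"
      show "sing_val S l u \<le> sv_threshold S"
      proof (cases "radar_msgs S l = {}")
        case False
        then obtain k where "k \<in> radar_msgs S l" by auto
        then show ?thesis using * sub[OF l] l u by (auto simp: radars_of_def)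
      qed (rule emp)
    qed
  qed (auto simp: radars_of_def)
  finally show ?thesis .
qed

end

section \<open>Transmission: received signals and power constraints\<close>

locale pms_transmission = pms_listing S bl rl
  for S :: "('l, 'm, 'w) pms" and bl rl +
  fixes Fr :: "nat \<Rightarrow> 'l \<Rightarrow> complex mat" and Fb :: "nat \<Rightarrow> 'm \<Rightarrow> complex mat"
  assumes precoders: "pms_precoders S Fr Fb"
begin

abbreviation "G \<equiv> gc_of_pms S bl rl"
abbreviation "F \<equiv> stacked_precoder S bl rl Fr Fb"

lemma msgs_users:
  "l \<in> radars S \<Longrightarrow> radar_msgs S l \<subseteq> users S" "m \<in> base_stations S \<Longrightarrow> bs_msgs S m \<subseteq> users S"
  using pms by (auto simp: mimo_ifc_pms_def)

lemma precoder_carrier: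
  "l \<in> radars S \<Longrightarrow> k \<in> radar_msgs S l \<Longrightarrow> Fr k l \<in> carrier_mat (n_rad S) (streams S k)"
  "m \<in> base_stations S \<Longrightarrow> k \<in> bs_msgs S m \<Longrightarrow> Fb k m \<in> carrier_mat (n_t S) (streams S k)"
  using precoders msgs_users unfolding pms_precoders_def radars_of_def bs_of_def by blast+

lemma symbols_carrier:
  "k \<in> users S \<Longrightarrow> \<omega> \<in> space (prob_sp S) \<Longrightarrow> symbols S k \<omega> \<in> carrier_vec (streams S k)"
  "k \<in> users S \<Longrightarrow> \<omega> \<in> space (prob_sp S) \<Longrightarrow> noise S k \<omega> \<in> carrier_vec (n_r S)"
  using pms by (auto simp: mimo_ifc_pms_def std_complex_normal_vec_def)

lemma precoder_block_carrier:
  assumes "k \<in> users S" "x \<in> set (stations bl rl k)"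
  shows "case_sum (Fb k) (Fr k) x \<in> carrier_mat (station_dim S x) (streams S k)"
  by (rule stations_cases[OF assms]) (use precoder_carrier in \<open>auto simp: station_dim_def\<close>)

lemma stacked_precoder_carrier:
  assumes "k \<in> users S"
  shows "F k \<in> carrier_mat (stacked_tx S k) (streams S k)"
  unfolding stacked_precoder_eq sum_station_dim[OF assms, symmetric]
  by (rule vcat_map_carrier) (rule precoder_block_carrier[OF assms])

lemma gc_users_eq: "gc_users G = users S"
  by (simp add: gc_users_def gc_of_pms_def users_def)

lemma gc_precoders_stacked: "gc_precoders G F"
  using stacked_precoder_carrier unfolding gc_precoders_def gc_users_eq by (simp add: gc_of_pms_def)

text \<open>With the projection absorbed into the precoders, the radar signal is a plain linear
  combination of symbol vectors, as the power computation expects.\<close>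

lemma radar_signal_eq:
  assumes l: "l \<in> radars S" and \<omega>: "\<omega> \<in> space (prob_sp S)"
  shows "radar_signal S Fr l \<omega>
    = finsum_vec TYPE(complex) (n_rad S) (\<lambda>k. (radar_proj S l * Fr k l) *\<^sub>v symbols S k \<omega>) (radar_msgs S l)"
proof -
  have Fu: "Fr k l *\<^sub>v symbols S k \<omega> \<in> carrier_vec (n_rad S)" if "k \<in> radar_msgs S l" for k
    using precoder_carrier(1)[OF l that] symbols_carrier(1)[of k] that msgs_users(1)[OF l] \<omega>
    by (auto intro!: mult_mat_vec_carrier)
  have "radar_signal S Fr l \<omega>
      = finsum_vec TYPE(complex) (n_rad S) (\<lambda>k. radar_proj S l *\<^sub>v (Fr k l *\<^sub>v symbols S k \<omega>)) (radar_msgs S l)"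
    unfolding radar_signal_def by (rule mult_finsum_vec[OF finites(4)[OF l] radar_proj_carrier[OF l] Fu])
  also have "\<dots> = finsum_vec TYPE(complex) (n_rad S) (\<lambda>k. (radar_proj S l * Fr k l) *\<^sub>v symbols S k \<omega>) (radar_msgs S l)"
    unfolding finsum_vec_def
  proof (rule comm_monoid.finprod_cong'[OF comm_monoid_vec])
    fix k assume k: "k \<in> radar_msgs S l"
    then have "symbols S k \<omega> \<in> carrier_vec (streams S k)" using msgs_users(1)[OF l] symbols_carrier \<omega> by auto
    then show "radar_proj S l *\<^sub>v (Fr k l *\<^sub>v symbols S k \<omega>) = (radar_proj S l * Fr k l) *\<^sub>v symbols S k \<omega>"
      using assoc_mult_mat_vec[OF radar_proj_carrier[OF l] precoder_carrier(1)[OF l k]] by simp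
  qed (use radar_proj_carrier[OF l] precoder_carrier(1)[OF l] in
      \<open>auto simp: monoid_vec_simps intro!: carrier_vecI\<close>)
  finally show ?thesis .
qed

lemma received_eq:
  assumes k: "k \<in> users S" and \<omega>: "\<omega> \<in> space (prob_sp S)"
  shows "pms_received S Fr Fb k \<omega> = gc_received G F k \<omega>"
proof -
  let ?u = "\<lambda>j. symbols S j \<omega>"
  let ?R = "\<lambda>j l. radar_chan S k l *\<^sub>v ((radar_proj S l * Fr j l) *\<^sub>v ?u j)"
  let ?B = "\<lambda>j m. bs_chan S k m *\<^sub>v (Fb j m *\<^sub>v ?u j)"
  let ?T = "\<lambda>j. stacked_chan S bl rl k j *\<^sub>v (F j *\<^sub>v ?u j)"
  have uc: "?u j \<in> carrier_vec (streams S j)" if "j \<in> users S" for j using symbols_carrier that \<omega> by auto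
  have PF: "(radar_proj S l * Fr j l) *\<^sub>v ?u j \<in> carrier_vec (n_rad S)"
    if "l \<in> radars S" "j \<in> radar_msgs S l" for l j
    using mult_carrier_mat[OF radar_proj_carrier[OF that(1)] precoder_carrier(1)[OF that]]
      uc[of j] that msgs_users(1) by (auto intro!: mult_mat_vec_carrier)
  have FB: "Fb j m *\<^sub>v ?u j \<in> carrier_vec (n_t S)" if "m \<in> base_stations S" "j \<in> bs_msgs S m" for m j
    using precoder_carrier(2)[OF that] uc[of j] that msgs_users(2) by (auto intro!: mult_mat_vec_carrier)
  have Rc: "?R j l \<in> carrier_vec (n_r S)" if "l \<in> radars S" for j l
    using chan_carrier(1)[OF k that] by (intro carrier_vecI) simp
  have Bc: "?B j m \<in> carrier_vec (n_r S)" if "m \<in> base_stations S" for j m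
    using chan_carrier(2)[OF k that] by (intro carrier_vecI) simp
  have Tc: "?T j \<in> carrier_vec (n_r S)" if "j \<in> users S" for j
    using stacked_chan_carrier[OF k that] by (intro carrier_vecI) simp
  have r: "radar_chan S k l *\<^sub>v radar_signal S Fr l \<omega> = finsum_vec TYPE(complex) (n_r S) (\<lambda>j. ?R j l) (radar_msgs S l)"
    if "l \<in> radars S" for l
    unfolding radar_signal_eq[OF that \<omega>]
    by (rule mult_finsum_vec[OF finites(4)[OF that] chan_carrier(1)[OF k that] PF[OF that]])
  have b: "bs_chan S k m *\<^sub>v bs_signal S Fb m \<omega> = finsum_vec TYPE(complex) (n_r S) (\<lambda>j. ?B j m) (bs_msgs S m)"
    if "m \<in> base_stations S" for m
    unfolding bs_signal_def
    by (rule mult_finsum_vec[OF finites(5)[OF that] chan_carrier(2)[OF k that] FB[OF that]])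
  have rc: "(\<lambda>l. radar_chan S k l *\<^sub>v radar_signal S Fr l \<omega>) \<in> radars S \<rightarrow> carrier_vec (n_r S)"
    using carrier_matD[OF chan_carrier(1)[OF k]] by (auto intro!: carrier_vecI)
  have bc: "(\<lambda>m. bs_chan S k m *\<^sub>v bs_signal S Fb m \<omega>) \<in> base_stations S \<rightarrow> carrier_vec (n_r S)"
    using carrier_matD[OF chan_carrier(2)[OF k]] by (auto intro!: carrier_vecI)
  have tc: "?T \<in> (users S - {k}) \<rightarrow> carrier_vec (n_r S)" using Tc by auto
  have nc: "noise S k \<omega> \<in> carrier_vec (n_r S)" using symbols_carrier k \<omega> by auto
  have gc: "gc_received G F k \<omega> = ?T k + finsum_vec TYPE(complex) (n_r S) ?T (users S - {k}) + noise S k \<omega>"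
    unfolding gc_received_def gc_signal_def gc_users_eq by (simp add: gc_of_pms_def)
  \<comment> \<open>What transmitter \<open>j\<close> delivers to receiver \<open>k\<close> is the
    sum of the contributions of the stations informed about \<open>j\<close>.\<close>
  have ext: "?T j $ i = (\<Sum>m\<in>bs_of S j. ?B j m $ i) + (\<Sum>l\<in>radars_of S j. ?R j l $ i)"
    if j: "j \<in> users S" and i: "i < n_r S" for i j
  proof -
    let ?f = "case_sum (bs_chan S k) (\<lambda>l. radar_chan S k l * radar_proj S l)" and ?g = "case_sum (Fb j) (Fr j)"
    have "?T j $ i = (\<Sum>x\<leftarrow>stations bl rl j. (?f x *\<^sub>v (?g x *\<^sub>v ?u j)) $ i)"
      unfolding stacked_chan_eq stacked_precoder_eq
      by (rule hcat_mult_vcat_index[where d = "station_dim S"])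
        (use chan_block_carrier[OF k j] precoder_block_carrier[OF j] uc[OF j] i in auto)
    also have "\<dots> = (\<Sum>m\<in>bs_of S j. ?B j m $ i)
        + (\<Sum>l\<in>radars_of S j. ((radar_chan S k l * radar_proj S l) *\<^sub>v (Fr j l *\<^sub>v ?u j)) $ i)"
      by (simp add: sum_stations[OF j])
    also have "(\<Sum>l\<in>radars_of S j. ((radar_chan S k l * radar_proj S l) *\<^sub>v (Fr j l *\<^sub>v ?u j)) $ i)
        = (\<Sum>l\<in>radars_of S j. ?R j l $ i)"
    proof (rule sum.cong)
      fix l assume "l \<in> radars_of S j"
      then have l: "l \<in> radars S" "j \<in> radar_msgs S l" by (auto simp: radars_of_def)
      note Fc = precoder_carrier(1)[OF l] and Pc = radar_proj_carrier[OF l(1)]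
      \<comment> \<open>Associativity moves the projection from the stacked channel, where the
        general model puts it, to the transmitted radar signal.\<close>
      have "(radar_chan S k l * radar_proj S l) *\<^sub>v (Fr j l *\<^sub>v ?u j) = ?R j l"
        using assoc_mult_mat_vec[OF chan_carrier(1)[OF k l(1)] Pc mult_mat_vec_carrier[OF Fc uc[OF j]]]
          assoc_mult_mat_vec[OF Pc Fc uc[OF j]] by simp
      then show "((radar_chan S k l * radar_proj S l) *\<^sub>v (Fr j l *\<^sub>v ?u j)) $ i = ?R j l $ i" by simp
    qed simp
    finally show ?thesis .
  qed
  \<comment> \<open>Double counting of pairs of a radar and a user known to it. Message sets lie in
    \<open>users S\<close>, so both iterated sums restrict the same rectangle.\<close>
  have swap_r: "(\<Sum>l\<in>radars S. \<Sum>j\<in>radar_msgs S l. h j l) = (\<Sum>j\<in>users S. \<Sum>l\<in>radars_of S j. h j l)" for h :: "nat \<Rightarrow> 'l \<Rightarrow> complex"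
  proof -
    have "(\<Sum>l\<in>radars S. \<Sum>j\<in>radar_msgs S l. h j l) = (\<Sum>l\<in>radars S. \<Sum>j\<in>{j \<in> users S. j \<in> radar_msgs S l}. h j l)"
      using msgs_users(1) by (intro sum.cong refl) auto
    then show ?thesis unfolding radars_of_def by (simp add: sum.swap_restrict[OF finites(1,3)])
  qed
  have swap_b: "(\<Sum>m\<in>base_stations S. \<Sum>j\<in>bs_msgs S m. h j m) = (\<Sum>j\<in>users S. \<Sum>m\<in>bs_of S j. h j m)" for h :: "nat \<Rightarrow> 'm \<Rightarrow> complex"
  proof -
    have "(\<Sum>m\<in>base_stations S. \<Sum>j\<in>bs_msgs S m. h j m) = (\<Sum>m\<in>base_stations S. \<Sum>j\<in>{j \<in> users S. j \<in> bs_msgs S m}. h j m)"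
      using msgs_users(2) by (intro sum.cong refl) auto
    then show ?thesis unfolding bs_of_def by (simp add: sum.swap_restrict[OF finites(2,3)])
  qed
  show ?thesis
  proof (rule eq_vecI)
    show "dim_vec (pms_received S Fr Fb k \<omega>) = dim_vec (gc_received G F k \<omega>)"
      using nc unfolding pms_received_def gc by simp
    fix i assume "i < dim_vec (gc_received G F k \<omega>)"
    then have i: "i < n_r S" using nc unfolding gc by simp
    have "pms_received S Fr Fb k \<omega> $ i
        = (\<Sum>l\<in>radars S. (radar_chan S k l *\<^sub>v radar_signal S Fr l \<omega>) $ i)
          + (\<Sum>m\<in>base_stations S. (bs_chan S k m *\<^sub>v bs_signal S Fb m \<omega>) $ i) + noise S k \<omega> $ i"
      using i nc finsum_vec_closed[OF rc] finsum_vec_closed[OF bc]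
        index_finsum_vec[OF finites(1) i rc] index_finsum_vec[OF finites(2) i bc]
      unfolding pms_received_def by simp
    moreover have "(\<Sum>l\<in>radars S. (radar_chan S k l *\<^sub>v radar_signal S Fr l \<omega>) $ i)
        = (\<Sum>j\<in>users S. \<Sum>l\<in>radars_of S j. ?R j l $ i)"
    proof -
      have "(radar_chan S k l *\<^sub>v radar_signal S Fr l \<omega>) $ i = (\<Sum>j\<in>radar_msgs S l. ?R j l $ i)"
        if "l \<in> radars S" for l
        unfolding r[OF that] by (rule index_finsum_vec[OF finites(4)[OF that] i]) (use Rc[OF that] in simp)
      then have "(\<Sum>l\<in>radars S. (radar_chan S k l *\<^sub>v radar_signal S Fr l \<omega>) $ i)
          = (\<Sum>l\<in>radars S. \<Sum>j\<in>radar_msgs S l. ?R j l $ i)" by (rule sum.cong[OF refl])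
      then show ?thesis using swap_r[of "\<lambda>j l. ?R j l $ i"] by (rule trans)
    qed
    moreover have "(\<Sum>m\<in>base_stations S. (bs_chan S k m *\<^sub>v bs_signal S Fb m \<omega>) $ i)
        = (\<Sum>j\<in>users S. \<Sum>m\<in>bs_of S j. ?B j m $ i)"
    proof -
      have "(bs_chan S k m *\<^sub>v bs_signal S Fb m \<omega>) $ i = (\<Sum>j\<in>bs_msgs S m. ?B j m $ i)"
        if "m \<in> base_stations S" for m
        unfolding b[OF that] by (rule index_finsum_vec[OF finites(5)[OF that] i]) (use Bc[OF that] in simp)
      then have "(\<Sum>m\<in>base_stations S. (bs_chan S k m *\<^sub>v bs_signal S Fb m \<omega>) $ i)
          = (\<Sum>m\<in>base_stations S. \<Sum>j\<in>bs_msgs S m. ?B j m $ i)" by (rule sum.cong[OF refl])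
      then show ?thesis using swap_b[of "\<lambda>j m. ?B j m $ i"] by (rule trans)
    qed
    moreover have "(\<Sum>j\<in>users S. ?T j $ i)
        = (\<Sum>j\<in>users S. \<Sum>m\<in>bs_of S j. ?B j m $ i) + (\<Sum>j\<in>users S. \<Sum>l\<in>radars_of S j. ?R j l $ i)"
      unfolding sum.distrib[symmetric] by (rule sum.cong[OF refl ext[OF _ i]])
    ultimately have pms_i: "pms_received S Fr Fb k \<omega> $ i = (\<Sum>j\<in>users S. ?T j $ i) + noise S k \<omega> $ i"
      by (simp only: add.commute)
    have "finsum_vec TYPE(complex) (n_r S) ?T (users S - {k}) $ i = (\<Sum>j\<in>users S - {k}. ?T j $ i)"
      by (rule index_finsum_vec[OF finite_Diff[OF finites(3)] i tc])
    \<comment> \<open>The general model lists the desired signal apart from the interference; here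
      it rejoins the sum over all users.\<close>
    then have "(\<Sum>j\<in>users S. ?T j $ i) = ?T k $ i + finsum_vec TYPE(complex) (n_r S) ?T (users S - {k}) $ i"
      using sum.remove[OF finites(3) k, of "\<lambda>j. ?T j $ i"] by (simp only:)
    moreover have "gc_received G F k \<omega> $ i
        = ?T k $ i + finsum_vec TYPE(complex) (n_r S) ?T (users S - {k}) $ i + noise S k \<omega> $ i"
      using i carrier_vecD[OF nc] carrier_vecD[OF Tc[OF k]] carrier_vecD[OF finsum_vec_closed[OF tc]]
      unfolding gc by (simp del: index_mult_mat_vec dim_mult_mat_vec)
    ultimately show "pms_received S Fr Fb k \<omega> $ i = gc_received G F k \<omega> $ i"
      using pms_i by (simp only:)
  qed
qed

lemma expected_signal_power:
  assumes "I \<subseteq> users S" and H: "\<And>k. k \<in> I \<Longrightarrow> H k \<in> carrier_mat n (streams S k)"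
  shows "complex_of_real (LINT \<omega>|prob_sp S. norm_sq (finsum_vec TYPE(complex) n (\<lambda>k. H k *\<^sub>v symbols S k \<omega>) I))
    = (\<Sum>k\<in>I. mtrace (H k * mat_adjoint (H k)))"
  by (rule expected_norm_sq_finsum_vec[where J = "users S" and d = "streams S"])
    (use pms assms finites in \<open>auto simp: mimo_ifc_pms_def dest: finite_subset\<close>)

lemma radar_tx_power_eq:
  assumes l: "l \<in> radars S"
  shows "complex_of_real (radar_tx_power S Fr l) = radar_tx_trace S Fr l"
proof -
  have "radar_tx_power S Fr l = (LINT \<omega>|prob_sp S. norm_sq (finsum_vec TYPE(complex) (n_rad S)
      (\<lambda>k. (radar_proj S l * Fr k l) *\<^sub>v symbols S k \<omega>) (radar_msgs S l)))"
    unfolding radar_tx_power_def by (intro Bochner_Integration.integral_cong refl) (simp add: radar_signal_eq[OF l])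
  then have "complex_of_real (radar_tx_power S Fr l)
      = (\<Sum>k\<in>radar_msgs S l. mtrace ((radar_proj S l * Fr k l) * mat_adjoint (radar_proj S l * Fr k l)))"
    using expected_signal_power[OF msgs_users(1)[OF l]]
      mult_carrier_mat[OF radar_proj_carrier[OF l] precoder_carrier(1)[OF l]] by simp
  also have "\<dots> = radar_tx_trace S Fr l"
    unfolding radar_tx_trace_def
    by (intro sum.cong refl)
      (rule mtrace_gram_mult(1)[OF radar_proj_carrier[OF l] precoder_carrier(1)[OF l], symmetric])
  finally show ?thesis .
qed

lemma bs_tx_power_eq:
  assumes m: "m \<in> base_stations S"
  shows "complex_of_real (bs_tx_power S Fb m) = bs_tx_trace S Fb m"
  unfolding bs_tx_power_def bs_signal_def bs_tx_trace_def
  by (rule expected_signal_power[OF msgs_users(2)[OF m] precoder_carrier(2)[OF m]])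

text \<open>The weight of radar \<open>l\<close> is supported on the block of \<open>l\<close>. A
  user informed at \<open>l\<close> thus contributes one trace and any other user contributes 0, so
  the sum over all users collapses to the message set.\<close>

lemma radar_tx_trace_eq:
  assumes l: "l \<in> radars S"
  shows "radar_tx_trace S Fr l = gc_lhs_L G F l"
proof -
  let ?P = "radar_proj S l"
  have *: "mtrace (stacked_weight_radar S bl rl k l * F k * mat_adjoint (F k))
      = (if k \<in> radar_msgs S l then mtrace (?P * Fr k l * mat_adjoint (Fr k l) * mat_adjoint ?P) else 0)"
    if k: "k \<in> users S" for k
  proof -
    let ?g = "case_sum (Fb k) (Fr k)"
    have "mtrace (stacked_weight_radar S bl rl k l * F k * mat_adjoint (F k))
        = (\<Sum>x\<leftarrow>stations bl rl k. mtrace (radar_block S k l x * ?g x * mat_adjoint (?g x)))"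
      unfolding stacked_weight_radar_eq[OF k] stacked_precoder_eq
      by (rule mtrace_diag_block_vcat[where d = "station_dim S"])
        (use radar_block_carrier[OF l] precoder_block_carrier[OF k] in auto)
    also have "\<dots> = (\<Sum>m\<in>bs_of S k. 0) + (\<Sum>l'\<in>radars_of S k. if l' = l then
        mtrace (?P * Fr k l * mat_adjoint (Fr k l) * mat_adjoint ?P) else 0)"
      unfolding sum_stations[OF k]
    proof (intro arg_cong2[where f = "(+)"] sum.cong refl)
      fix m assume "m \<in> bs_of S k"
      then show "mtrace (radar_block S k l (Inl m) * ?g (Inl m) * mat_adjoint (?g (Inl m))) = 0"
        using mtrace_zero_mult[OF precoder_carrier(2)] by (auto simp: radar_block_def bs_of_def)
    next
      fix l' assume l': "l' \<in> radars_of S k"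
      show "mtrace (radar_block S k l (Inr l') * ?g (Inr l') * mat_adjoint (?g (Inr l')))
        = (if l' = l then mtrace (?P * Fr k l * mat_adjoint (Fr k l) * mat_adjoint ?P) else 0)"
        using mtrace_zero_mult[OF precoder_carrier(1)] l' precoder_carrier(1)[of l' k] mtrace_gram_mult(2)[OF radar_proj_carrier[OF l]]
        by (auto simp: radar_block_def radars_of_def)
    qed
    \<comment> \<open>Since \<open>l\<close> is a radar, it occurs in \<open>radars_of S k\<close>
      exactly when \<open>k\<close> is in its message set.\<close>
    also have "\<dots> = (if k \<in> radar_msgs S l then mtrace (?P * Fr k l * mat_adjoint (Fr k l) * mat_adjoint ?P) else 0)"
      using l finites(1) by (simp add: radars_of_def)
    finally show ?thesis .
  qed
  have "gc_lhs_L G F l = (\<Sum>k\<in>users S. mtrace (stacked_weight_radar S bl rl k l * F k * mat_adjoint (F k)))"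
    unfolding gc_lhs_L_def gc_users_eq by (simp add: gc_of_pms_def)
  also have "\<dots> = (\<Sum>k\<in>users S. if k \<in> radar_msgs S l then
      mtrace (?P * Fr k l * mat_adjoint (Fr k l) * mat_adjoint ?P) else 0)"
    by (intro sum.cong refl *)
  also have "\<dots> = radar_tx_trace S Fr l"
    unfolding radar_tx_trace_def using msgs_users(1)[OF l] finites(3)
    by (simp add: sum.inter_restrict[symmetric] inf.absorb2)
  finally show ?thesis by simp
qed

lemma bs_tx_trace_eq:
  assumes m: "m \<in> base_stations S"
  shows "bs_tx_trace S Fb m = gc_lhs_M G F m"
proof -
  have *: "mtrace (stacked_weight_bs S bl rl k m * F k * mat_adjoint (F k))
      = (if k \<in> bs_msgs S m then mtrace (Fb k m * mat_adjoint (Fb k m)) else 0)"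
    if k: "k \<in> users S" for k
  proof -
    let ?g = "case_sum (Fb k) (Fr k)"
    have "mtrace (stacked_weight_bs S bl rl k m * F k * mat_adjoint (F k))
        = (\<Sum>x\<leftarrow>stations bl rl k. mtrace (bs_block S k m x * ?g x * mat_adjoint (?g x)))"
      unfolding stacked_weight_bs_eq[OF k] stacked_precoder_eq
      by (rule mtrace_diag_block_vcat[where d = "station_dim S"])
        (use bs_block_carrier precoder_block_carrier[OF k] in auto)
    also have "\<dots> = (\<Sum>m'\<in>bs_of S k. if m' = m then mtrace (Fb k m * mat_adjoint (Fb k m)) else 0)
        + (\<Sum>l\<in>radars_of S k. 0)"
      unfolding sum_stations[OF k]
    proof (intro arg_cong2[where f = "(+)"] sum.cong refl)
      fix l assume "l \<in> radars_of S k"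
      then show "mtrace (bs_block S k m (Inr l) * ?g (Inr l) * mat_adjoint (?g (Inr l))) = 0"
        using mtrace_zero_mult[OF precoder_carrier(1)] by (auto simp: bs_block_def radars_of_def)
    next
      fix m' assume m': "m' \<in> bs_of S k"
      show "mtrace (bs_block S k m (Inl m') * ?g (Inl m') * mat_adjoint (?g (Inl m')))
        = (if m' = m then mtrace (Fb k m * mat_adjoint (Fb k m)) else 0)"
        using mtrace_zero_mult[OF precoder_carrier(2)] m' precoder_carrier(2)[of m' k]
        by (auto simp: bs_block_def bs_of_def)
    qed
    also have "\<dots> = (if k \<in> bs_msgs S m then mtrace (Fb k m * mat_adjoint (Fb k m)) else 0)"
      using m finites(2) by (simp add: bs_of_def)
    finally show ?thesis .
  qed
  have "gc_lhs_M G F m = (\<Sum>k\<in>users S. mtrace (stacked_weight_bs S bl rl k m * F k * mat_adjoint (F k)))"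
    unfolding gc_lhs_M_def gc_users_eq by (simp add: gc_of_pms_def)
  also have "\<dots> = (\<Sum>k\<in>users S. if k \<in> bs_msgs S m then mtrace (Fb k m * mat_adjoint (Fb k m)) else 0)"
    by (intro sum.cong refl *)
  also have "\<dots> = bs_tx_trace S Fb m"
    unfolding bs_tx_trace_def using msgs_users(2)[OF m] finites(3)
    by (simp add: sum.inter_restrict[symmetric] inf.absorb2)
  finally show ?thesis by simp
qed

text \<open>Both sides of the complex inequality are images of real numbers, so their imaginary
  parts agree and the complex order reduces to the real one.\<close>

lemma radar_constraint_iff:
  assumes "l \<in> radars S"
  shows "pms_radar_constraint S Fr l \<longleftrightarrow> gc_constraint_L G F l"
  unfolding pms_radar_constraint_def gc_constraint_L_def radar_tx_trace_eq[OF assms, symmetric]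
    radar_tx_power_eq[OF assms, symmetric]
  by (simp add: gc_of_pms_def less_eq_complex_def)

lemma bs_constraint_iff:
  assumes "m \<in> base_stations S"
  shows "pms_bs_constraint S Fb m \<longleftrightarrow> gc_constraint_M G F m"
  unfolding pms_bs_constraint_def gc_constraint_M_def bs_tx_trace_eq[OF assms, symmetric]
    bs_tx_power_eq[OF assms, symmetric]
  by (simp add: gc_of_pms_def less_eq_complex_def)

end

theorem mainTheorem1:
  fixes S :: "('l, 'm, 'w) pms"
    and bl :: "nat \<Rightarrow> 'm list" and rl :: "nat \<Rightarrow> 'l list"
    and Fr :: "nat \<Rightarrow> 'l \<Rightarrow> complex mat" and Fb :: "nat \<Rightarrow> 'm \<Rightarrow> complex mat"
  assumes "mimo_ifc_pms S"
    and "station_listing S bl rl"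
    and "pms_precoders S Fr Fb"
  shows "(gc_model (gc_of_pms S bl rl)) \<and>
    (\<forall>k\<in>users S. positive_semidefinite (stacked_tx S k) (gc_weight_sum (gc_of_pms S bl rl) k)) \<and>
    (mimo_ifc_gc (gc_of_pms S bl rl) \<longleftrightarrow>
           (\<forall>l\<in>radars S. \<forall>u<n_rad S. sing_val S l u \<le> sv_threshold S)) \<and>
    (gc_precoders (gc_of_pms S bl rl) (stacked_precoder S bl rl Fr Fb)) \<and>
    (\<forall>k\<in>users S. \<forall>\<omega>\<in>space (prob_sp S). pms_received S Fr Fb k \<omega>
           = gc_received (gc_of_pms S bl rl) (stacked_precoder S bl rl Fr Fb) k \<omega>) \<and>
    (\<forall>l\<in>radars S.
           complex_of_real (radar_tx_power S Fr l) = radar_tx_trace S Fr l \<and>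
           radar_tx_trace S Fr l
             = gc_lhs_L (gc_of_pms S bl rl) (stacked_precoder S bl rl Fr Fb) l \<and>
           (pms_radar_constraint S Fr l
             \<longleftrightarrow> gc_constraint_L (gc_of_pms S bl rl) (stacked_precoder S bl rl Fr Fb) l)) \<and>
    (\<forall>m\<in>base_stations S.
           complex_of_real (bs_tx_power S Fb m) = bs_tx_trace S Fb m \<and>
           bs_tx_trace S Fb m
             = gc_lhs_M (gc_of_pms S bl rl) (stacked_precoder S bl rl Fr Fb) m \<and>
           (pms_bs_constraint S Fb m
             \<longleftrightarrow> gc_constraint_M (gc_of_pms S bl rl) (stacked_precoder S bl rl Fr Fb) m))"
proof -
  interpret pms_transmission S bl rl Fr Fb
    using assms by unfold_locales
  show ?thesis
    using gc_model_gc_of_pms positive_semidefinite_gc_weight_sum mimo_ifc_gc_iff gc_precoders_stacked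
      received_eq radar_tx_power_eq radar_tx_trace_eq radar_constraint_iff
      bs_tx_power_eq bs_tx_trace_eq bs_constraint_iff
    by blast
qed

end
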